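(* Let $m \ge 2$ and let $P \subset \mathbb{R}^m$ be an $o$-symmetric convex polytope with nonempty interior such that $n(P) = 3^m - 1$. Then: (1) $P$ is a zonotope. (2) If $m = 3$, then no angle of any ($2$-dimensional) face of $P$ is acute, and $P$ has a face that is a rectangle.
   Context: A convex body in $\mathbb{R}^m$ is a compact convex set with nonempty interior; $\mathrm{bd}\,K$ denotes its boundary and $\mathrm{vol}$ denotes $m$-dimensional Lebesgue measure; $o$ is the origin, and $K$ is $o$-symmetric if $K=-K$. For a convex body $K$ and $q \in \mathrm{bd}\,K$, a line starting at $q$ and perpendicular to a supporting hyperplane of $K$ at $q$ is called a normal of $K$ at $q$. For $p \in K$, $n(K,p)$ denotes the number of normals of $K$ passing through $p$; normals are counted according to their starting points, so a line that is a normal at both of its boundary points is counted twice. Set $$I(K) = \int_{K} n(K,p)\, dp, \qquad n(K) = \frac{I(K)}{\mathrm{vol}(K)}.$$ A zonotope is a Minkowski sum of finitely many closed segments (equivalently, a centrally symmetric polytope all of whose faces are centrally symmetric). *)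

theory Defs
  imports "HOL-Analysis.Analysis" "HOL-Library.Set_Algebras"
begin

text \<open>The supporting hyperplanes of K at q are the sets {x. u \<bullet> x = u \<bullet> q} with u as below;
  u is an outer normal direction.\<close>

definition supports_at :: "'a::euclidean_space set \<Rightarrow> 'a \<Rightarrow> 'a \<Rightarrow> bool" where
  "supports_at K q u \<longleftrightarrow> u \<noteq> 0 \<and> (\<forall>x\<in>K. u \<bullet> x \<le> u \<bullet> q)"

definition normals_at :: "'a::euclidean_space set \<Rightarrow> 'a \<Rightarrow> 'a set set" where
  "normals_at K q = {L. \<exists>u. supports_at K q u \<and> L = range (\<lambda>t::real. q + t *\<^sub>R u)}"

text \<open>A normal is counted together with its starting point q, so a line that is a normal at both
  of its boundary points contributes 2. The value is \<open>\<infinity>\<close> if there are infinitely many normals.\<close>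

definition normals_through :: "'a::euclidean_space set \<Rightarrow> 'a \<Rightarrow> ('a \<times> 'a set) set" where
  "normals_through K p = {(q, L). q \<in> frontier K \<and> L \<in> normals_at K q \<and> p \<in> L}"

definition num_normals :: "'a::euclidean_space set \<Rightarrow> 'a \<Rightarrow> ennreal" where
  "num_normals K p = emeasure (count_space UNIV) (normals_through K p)"

definition normals_integral :: "'a::euclidean_space set \<Rightarrow> ennreal" where
  "normals_integral K = (\<integral>\<^sup>+p\<in>K. num_normals K p \<partial>lebesgue)"

definition avg_normals :: "'a::euclidean_space set \<Rightarrow> ennreal" where
  "avg_normals K = normals_integral K / emeasure lebesgue K"

text \<open>The sum is the Minkowski sum of sets.\<close>

definition zonotope :: "'a::euclidean_space set \<Rightarrow> bool" where
  "zonotope Z \<longleftrightarrow>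
     (\<exists>(k::nat) (a::nat \<Rightarrow> 'a) b. Z = (\<Sum>i<k. closed_segment (a i) (b i)))"

definition vertex_angle :: "'a::euclidean_space \<Rightarrow> 'a \<Rightarrow> 'a \<Rightarrow> real" where
  "vertex_angle a b c = arccos (((a - b) \<bullet> (c - b)) / (norm (a - b) * norm (c - b)))"

text \<open>The interior angles of a convex polygon F: for each vertex b, the angle between the two
  edges of F meeting at b.\<close>

definition polygon_angles :: "'a::euclidean_space set \<Rightarrow> real set" where
  "polygon_angles F = {vertex_angle a b c |a b c. a \<noteq> c \<and>
     closed_segment b a edge_of F \<and> closed_segment b c edge_of F}"

definition rectangle :: "'a::euclidean_space set \<Rightarrow> bool" where
  "rectangle R \<longleftrightarrow> (\<exists>a u v. u \<noteq> 0 \<and> v \<noteq> 0 \<and> u \<bullet> v = 0 \<and>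
     R = convex hull {a, a + u, a + u + v, a + v})"

end

theory Submission
  imports Defs
begin

text \<open>
  Let \<open>\<pi>\<close> be the nearest-point map of the polytope \<open>P\<close> in dimension \<open>m\<close> and \<open>T x = 2 \<pi>(x) - x\<close>. A normal at \<open>q\<close> that
  passes through an interior point \<open>p\<close> comes from exactly one \<open>x \<noteq> p\<close> with \<open>T x = p\<close> and
  \<open>\<pi>(x) = q\<close>, namely \<open>x = 2 q - p\<close>, and this \<open>x\<close> lies in \<open>3 P\<close> because \<open>P = -P\<close>. On the set of
  points whose nearest point lies in the relative interior of a fixed face, \<open>T\<close> is injective, and \<open>T\<close>
  never increases volume since it is nonexpansive. Summing over the faces, the integral of the number
  of normals plus \<open>vol P\<close> is at most the volume of \<open>3 P \<inter> T\<^sup>-\<^sup>1(P)\<close>, hence at most \<open>3\<^sup>m vol P\<close>. An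
  average of \<open>3\<^sup>m - 1\<close> normals therefore forces \<open>T(3 P) \<subseteq> P\<close> (\<open>reflect_nearest_dilate_subset\<close>).

  Everything else follows from this inclusion. If \<open>g\<close> lies in a face \<open>G\<close> and \<open>r = \<pi>(3 g)\<close>, then \<open>g\<close>
  is a convex combination of \<open>r\<close> and \<open>3 g - 2 r\<close>, so both lie in \<open>G\<close>. It follows by induction on the
  dimension that the foot of the perpendicular from the origin to the affine hull of a face lies in
  that face, and that the face is symmetric about it (\<open>face_has_foot\<close>,
  \<open>face_symmetric_about_foot\<close>). In particular the two ends of every edge are equally far from the
  origin, and the theorem of Thales shows that the angles of the polygonal faces are not acute.

  Central symmetry of the polygonal faces makes \<open>P\<close> a zonotope. Every maximal face in a direction
  orthogonal to an edge vector \<open>e\<close> again contains an edge with vector \<open>e\<close>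
  (\<open>edge_directions_of_all_maximal_faces\<close>). Along a generic line the support function of \<open>P\<close> thus has
  the same kinks as the support function of the sum of one segment for each edge direction, so that
  their difference is affine on the line; by symmetry it vanishes (\<open>support_eq_sum_edges\<close>).

  In dimension three the edge directions are points of a projective plane, not all on one line, so
  by the theorem of Sylvester and Gallai some line carries exactly two of them. A normal of
  the corresponding plane exposes a parallelogram face, and since the ends of its sides are equally far
  from the origin, the parallelogram is a rectangle.
\<close>

section \<open>Volume under nonexpansive maps\<close>

text \<open>By Vitali's theorem almost all of \<open>A\<close> is covered by disjoint balls centred in \<open>A\<close> whose total volume
  exceeds that of \<open>A\<close> by at most \<open>e\<close>. The image of a ball lies in a ball of the same radius, and null
  sets have null images.\<close>

lemma emeasure_nonexpansive_image_le:
  fixes f :: "'a::euclidean_space \<Rightarrow> 'a"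
  assumes lip: "\<And>x y. dist (f x) (f y) \<le> dist x y" and A: "A \<in> sets lebesgue"
  shows "f ` A \<in> sets lebesgue" and "emeasure lebesgue (f ` A) \<le> emeasure lebesgue A"
proof -
  have neg: "negligible (f ` N)" if "negligible N" for N
  proof (rule negligible_locally_Lipschitz_image)
    show "\<exists>T B. open T \<and> x \<in> T \<and> (\<forall>y \<in> N \<inter> T. norm (f y - f x) \<le> B * norm (y - x))" for x
      using lip by (intro exI[of _ UNIV] exI[of _ 1]) (auto simp: dist_norm)
  qed (use that in auto)
  have cont: "continuous_on S f" for S
    unfolding continuous_on_iff using le_less_trans[OF lip] by blast
  show meas: "f ` A \<in> sets lebesgue"
    by (rule sets_lebesgue_continuous_image[OF A cont[of A] neg]) auto
  show "emeasure lebesgue (f ` A) \<le> emeasure lebesgue A"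
  proof (rule ennreal_le_epsilon)
    fix e :: real assume "0 < e"
    obtain U where U: "open U" "A \<subseteq> U" "(U - A) \<in> lmeasurable" "emeasure lebesgue (U - A) < ennreal e"
      by (rule sets_lebesgue_outer_open[OF A \<open>0 < e\<close>])
    have "emeasure lebesgue U = emeasure lebesgue (A \<union> (U - A))"
      using U(2) by (simp add: Un_absorb1)
    also have "\<dots> \<le> emeasure lebesgue A + emeasure lebesgue (U - A)"
      using A U(3) by (intro emeasure_subadditive) auto
    finally have eU: "emeasure lebesgue U \<le> emeasure lebesgue A + ennreal e"
      using U(4) by (meson add_left_mono less_imp_le order_trans)
    define K where "K = {(a, r). a \<in> A \<and> 0 < r \<and> cball a r \<subseteq> U}"
    have cover: "\<exists>i. i \<in> K \<and> x \<in> cball (fst i) (snd i) \<and> snd i < d" if "x \<in> A" "0 < d" for x d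
    proof -
      obtain r where "0 < r" "cball x r \<subseteq> U"
        using U(1,2) \<open>x \<in> A\<close> open_contains_cball by blast
      then have "(x, min r (d / 2)) \<in> K"
        using that by (auto simp: K_def)
      then show ?thesis
        using \<open>0 < d\<close> \<open>0 < r\<close> by (intro exI[of _ "(x, min r (d / 2))"]) auto
    qed
    have pos: "0 < snd i" if "i \<in> K" for i
      using that by (auto simp: K_def)
    obtain C where C: "countable C" "C \<subseteq> K"
        and disj: "pairwise (\<lambda>i j. disjnt (cball (fst i) (snd i)) (cball (fst j) (snd j))) C"
        and negC: "negligible (A - (\<Union>i\<in>C. cball (fst i) (snd i)))"
      by (rule Vitali_covering_theorem_cballs[OF pos cover])
    define ix where "ix = to_nat_on C ` C"
    define e' where "e' = from_nat_into C"
    have ixC: "e' n \<in> C" if "n \<in> ix" for n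
      using that C(1) by (auto simp: ix_def e'_def)
    have Cix: "\<exists>n\<in>ix. e' n = i" if "i \<in> C" for i
      using that C(1) by (auto simp: ix_def e'_def)
    have inj: "e' m \<noteq> e' n" if "m \<in> ix" "n \<in> ix" "m \<noteq> n" for m n
      using that C(1) by (auto simp: ix_def e'_def)
    define B where "B = (\<lambda>n. if n \<in> ix then cball (fst (e' n)) (snd (e' n)) else {})"
    define B' where "B' = (\<lambda>n. if n \<in> ix then cball (f (fst (e' n))) (snd (e' n)) else {})"
    have sub: "f ` A \<subseteq> f ` (A - (\<Union>i\<in>C. cball (fst i) (snd i))) \<union> (\<Union>n. B' n)"
    proof
      fix y assume "y \<in> f ` A"
      then obtain x where x: "x \<in> A" "y = f x" by blast
      show "y \<in> f ` (A - (\<Union>i\<in>C. cball (fst i) (snd i))) \<union> (\<Union>n. B' n)"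
      proof (cases "x \<in> (\<Union>i\<in>C. cball (fst i) (snd i))")
        case True
        then obtain n where n: "n \<in> ix" "x \<in> cball (fst (e' n)) (snd (e' n))"
          using Cix by blast
        then have "y \<in> B' n"
          using lip[of "fst (e' n)" x] x by (auto simp: B'_def)
        then show ?thesis by blast
      qed (use x in blast)
    qed
    have "disjoint_family B"
    proof (clarsimp simp: disjoint_family_on_def)
      fix m n :: nat assume "m \<noteq> n"
      show "B m \<inter> B n = {}"
      proof (cases "m \<in> ix \<and> n \<in> ix")
        case True
        then show ?thesis
          using pairwiseD[OF disj ixC ixC inj] \<open>m \<noteq> n\<close> by (auto simp: B_def disjnt_def)
      qed (auto simp: B_def)
    qed
    have same: "emeasure lebesgue (B' n) = emeasure lebesgue (B n)" for n
    proof (cases "n \<in> ix")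
      case True
      then have "0 < snd (e' n)" using ixC C(2) by (force simp: K_def)
      then show ?thesis
        by (simp add: B_def B'_def emeasure_cball)
    qed (auto simp: B_def B'_def)
    have "emeasure lebesgue (f ` A)
        \<le> emeasure lebesgue (f ` (A - (\<Union>i\<in>C. cball (fst i) (snd i))) \<union> (\<Union>n. B' n))"
      using sub neg[OF negC]
      by (intro emeasure_mono) (auto simp: B'_def negligible_imp_sets)
    also have "\<dots> \<le> emeasure lebesgue (f ` (A - (\<Union>i\<in>C. cball (fst i) (snd i))))
        + emeasure lebesgue (\<Union>n. B' n)"
      using neg[OF negC] by (intro emeasure_subadditive) (auto simp: B'_def negligible_imp_sets)
    also have "emeasure lebesgue (f ` (A - (\<Union>i\<in>C. cball (fst i) (snd i)))) = 0"
      using neg[OF negC] by (simp only: negligible_iff_null_sets null_setsD1)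
    also have "0 + emeasure lebesgue (\<Union>n. B' n) \<le> (\<Sum>n. emeasure lebesgue (B' n))"
      unfolding add_0 by (intro emeasure_subadditive_countably) (auto simp: B'_def)
    also have "\<dots> = (\<Sum>n. emeasure lebesgue (B n))"
      by (simp add: same)
    also have "\<dots> = emeasure lebesgue (\<Union>n. B n)"
      using \<open>disjoint_family B\<close> by (intro suminf_emeasure) (auto simp: B_def)
    also have "\<dots> \<le> emeasure lebesgue U"
    proof (rule emeasure_mono)
      show "(\<Union>n. B n) \<subseteq> U"
        using ixC C(2) by (auto simp: B_def K_def split: if_splits dest!: subsetD)
    qed (use U(1) in auto)
    also note eU
    finally show "emeasure lebesgue (f ` A) \<le> emeasure lebesgue A + ennreal e" .
  qed
qed

section \<open>Reflection in the nearest point\<close>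

definition reflect_nearest :: "'a::euclidean_space set \<Rightarrow> 'a \<Rightarrow> 'a" where
  "reflect_nearest K x = 2 *\<^sub>R closest_point K x - x"

lemma closest_pointI:
  fixes K :: "'a::euclidean_space set"
  assumes "convex K" "closed K" "q \<in> K" "\<And>z. z \<in> K \<Longrightarrow> (x - q) \<bullet> (z - q) \<le> 0"
  shows "closest_point K x = q"
proof -
  have "dist x q \<le> dist x z" if "z \<in> K" for z
  proof -
    have "(norm (x - q))\<^sup>2 \<le> (norm (x - z))\<^sup>2"
      using assms(4)[OF that] zero_le_square[of "norm (z - q)"]
      unfolding power2_norm_eq_inner
      by (smt (verit) inner_commute inner_diff_left inner_diff_right inner_ge_zero)
    then show ?thesis by (simp add: dist_norm)
  qed
  then show ?thesis
    using closest_point_unique[of K q x] assms by auto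
qed

text \<open>With \<open>p\<close>, \<open>q\<close> the nearest points of \<open>x\<close>, \<open>y\<close>, the two obtuse-angle inequalities at \<open>p\<close> and \<open>q\<close> add
  up to \<open>\<bar>p - q\<bar>\<^sup>2 \<le> (p - q) \<bullet> (x - y)\<close>, which is the claim after expanding squares.\<close>

lemma reflect_nearest_nonexpansive:
  fixes K :: "'a::euclidean_space set"
  assumes "convex K" "closed K" "K \<noteq> {}"
  shows "dist (reflect_nearest K x) (reflect_nearest K y) \<le> dist x y"
proof -
  define p q where "p = closest_point K x" and "q = closest_point K y"
  have "(x - p) \<bullet> (q - p) \<le> 0" "(y - q) \<bullet> (p - q) \<le> 0"
    unfolding p_def q_def using assms
    by (auto intro!: closest_point_dot closest_point_in_set)
  then have "((2 *\<^sub>R p - x) - (2 *\<^sub>R q - y)) \<bullet> ((2 *\<^sub>R p - x) - (2 *\<^sub>R q - y)) \<le> (x - y) \<bullet> (x - y)"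
    by (simp add: inner_diff_left inner_diff_right inner_commute algebra_simps)
  then show ?thesis
    by (simp add: reflect_nearest_def dist_norm norm_le p_def q_def)
qed

text \<open>The required face is a minimal one that contains \<open>q\<close>: a relative boundary point of it would lie in a
  smaller face.\<close>

lemma rel_interior_face_cover:
  fixes P :: "'a::euclidean_space set"
  assumes "polytope P" "q \<in> P"
  obtains F where "F face_of P" "q \<in> rel_interior F"
proof -
  define \<F> where "\<F> = {F. F face_of P \<and> q \<in> F}"
  have "finite \<F>"
    using finite_polytope_faces[OF assms(1)] by (rule rev_finite_subset) (auto simp: \<F>_def)
  moreover have "P \<in> \<F>"
    using assms by (simp add: \<F>_def face_of_refl_eq polytope_imp_convex)
  ultimately obtain F where F: "F \<in> \<F>" and min: "\<And>G. G \<in> \<F> \<Longrightarrow> G \<subseteq> F \<Longrightarrow> G = F"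
    using finite_has_minimal[of \<F>] by (metis empty_iff)
  have face: "F face_of P" and q: "q \<in> F" using F by (auto simp: \<F>_def)
  have poly: "polyhedron F"
    using assms(1) face face_of_polytope_polytope polytope_imp_polyhedron by blast
  have "q \<in> rel_interior F"
  proof (rule ccontr)
    assume "q \<notin> rel_interior F"
    then have "q \<in> rel_frontier F"
      using q closure_subset by (auto simp: rel_frontier_def)
    then obtain G where "G face_of F" "G \<noteq> F" "q \<in> G"
      using rel_frontier_of_polyhedron_alt[OF poly] by auto
    moreover have "G \<in> \<F>"
      using \<open>G face_of F\<close> \<open>q \<in> G\<close> face face_of_trans by (auto simp: \<F>_def)
    ultimately show False
      using min[of G] face_of_imp_subset[of G F] by simp
  qed
  then show ?thesis using that face by blast
qed

text \<open>From a relative interior point one can move inside \<open>F\<close> both towards \<open>q'\<close> and away from it, so the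
  functional \<open>w\<close>, maximal over \<open>F\<close> at \<open>q\<close>, is constant in that direction.\<close>

lemma normal_orthogonal_to_face:
  fixes F :: "'a::euclidean_space set"
  assumes "q \<in> rel_interior F" "q' \<in> F" "\<And>z. z \<in> F \<Longrightarrow> w \<bullet> (z - q) \<le> 0"
  shows "w \<bullet> (q' - q) = 0"
proof (cases "q' = q")
  case False
  obtain e where e: "e > 0" "cball q e \<inter> affine hull F \<subseteq> F" and q: "q \<in> F"
    using assms(1) by (auto simp: rel_interior_cball)
  define z where "z = q - (e / norm (q' - q)) *\<^sub>R (q' - q)"
  have "z \<in> affine hull F"
    unfolding z_def using q assms(2) by (intro mem_affine_3_minus2) (auto simp: hull_inc)
  moreover have "z \<in> cball q e"
    using e(1) False by (simp add: z_def dist_norm)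
  ultimately have "z \<in> F" using e(2) by blast
  then have "w \<bullet> (z - q) \<le> 0" by (rule assms(3))
  then have "- (e / norm (q' - q)) * (w \<bullet> (q' - q)) \<le> 0"
    by (simp add: z_def)
  moreover have "e / norm (q' - q) > 0" using e(1) False by simp
  ultimately have "w \<bullet> (q' - q) \<ge> 0"
    by (smt (verit) mult_minus_left mult_pos_neg)
  then show ?thesis using assms(3)[OF assms(2)] by linarith
qed auto

text \<open>If \<open>p\<close>, \<open>q\<close> are the nearest points of \<open>x\<close>, \<open>y\<close>, then \<open>x - p\<close> and \<open>y - q\<close> are orthogonal to \<open>p - q\<close>
  because \<open>p\<close>, \<open>q\<close> are relatively interior to the same face. Equal images give
  \<open>(x - p) - (y - q) = p - q\<close>, and this vector is orthogonal to itself.\<close>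

lemma reflect_nearest_inj_on_cell:
  fixes P :: "'a::euclidean_space set"
  assumes "convex P" "closed P" "F face_of P"
  shows "inj_on (reflect_nearest P) {x. closest_point P x \<in> rel_interior F}"
proof (rule inj_onI, clarify)
  fix x y
  define p q where "p = closest_point P x" and "q = closest_point P y"
  assume "closest_point P x \<in> rel_interior F" "closest_point P y \<in> rel_interior F"
    and eq: "reflect_nearest P x = reflect_nearest P y"
  then have pq: "p \<in> rel_interior F" "q \<in> rel_interior F" by (auto simp: p_def q_def)
  have FP: "F \<subseteq> P" using assms(3) face_of_imp_subset by blast
  have pqF: "p \<in> F" "q \<in> F" using pq rel_interior_subset by auto
  have 1: "(x - p) \<bullet> (q - p) = 0"
    by (rule normal_orthogonal_to_face[OF pq(1) pqF(2)])
      (use FP assms closest_point_dot p_def in blast)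
  have 2: "(y - q) \<bullet> (p - q) = 0"
    by (rule normal_orthogonal_to_face[OF pq(2) pqF(1)])
      (use FP assms closest_point_dot q_def in blast)
  have eq': "2 *\<^sub>R p - x = 2 *\<^sub>R q - y" using eq by (simp add: reflect_nearest_def p_def q_def)
  then have "(x - p) - (y - q) = p - q"
    by (simp add: scaleR_2 algebra_simps)
  then have "(p - q) \<bullet> (p - q) = ((x - p) - (y - q)) \<bullet> (p - q)" by simp
  also have "\<dots> = 0"
    using 1 2 by (simp add: inner_diff_left inner_diff_right algebra_simps)
  finally have "p = q" by simp
  then show "x = y" using eq' by simp
qed


section \<open>Normals and the volume of the dilate by three\<close>

text \<open>Seen from an interior point, a normal at \<open>q\<close> leaves the body at \<open>q\<close>, and the reflected point
  \<open>2 q - p\<close> lies on its outer part. Hence \<open>q\<close> alone determines the line and is recovered as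
  the nearest point of \<open>2 q - p\<close>.\<close>

lemma normals_through_nearest:
  fixes P :: "'a::euclidean_space set"
  assumes "convex P" "closed P" and p: "p \<in> interior P" and qL: "(q, L) \<in> normals_through P p"
  shows "q \<in> P" "closest_point P (2 *\<^sub>R q - p) = q" "2 *\<^sub>R q - p \<notin> P"
    and "L = range (\<lambda>s. q + s *\<^sub>R (p - q))"
proof -
  obtain u t where q: "q \<in> frontier P" and u: "u \<noteq> 0" "\<And>x. x \<in> P \<Longrightarrow> u \<bullet> x \<le> u \<bullet> q"
    and L: "L = range (\<lambda>t. q + t *\<^sub>R u)" and t: "p = q + t *\<^sub>R u"
    using qL by (auto simp: normals_through_def normals_at_def supports_at_def)
  show "q \<in> P" using q \<open>closed P\<close> frontier_subset_closed by blast
  have "p \<noteq> q" using p q by (auto simp: frontier_def)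
  have "p \<in> P" using p interior_subset by blast
  then have "t * (u \<bullet> u) \<le> 0" using u(2)[of p] by (simp add: t inner_add_right)
  moreover have "u \<bullet> u > 0" using u(1) by simp
  ultimately have "t \<le> 0" by (simp add: mult_le_0_iff)
  have "(2 *\<^sub>R q - p - q) \<bullet> (z - q) \<le> 0" if "z \<in> P" for z
  proof -
    have "2 *\<^sub>R q - p - q = (- t) *\<^sub>R u" by (simp add: t scaleR_2)
    then have "(2 *\<^sub>R q - p - q) \<bullet> (z - q) = - t * (u \<bullet> (z - q))" by simp
    also have "\<dots> \<le> 0"
      using \<open>t \<le> 0\<close> u(2)[OF that] by (simp add: inner_diff_right mult_nonpos_nonpos)
    finally show ?thesis .
  qed
  then show cp: "closest_point P (2 *\<^sub>R q - p) = q"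
    using assms(1,2) \<open>q \<in> P\<close> by (intro closest_pointI) auto
  show "2 *\<^sub>R q - p \<notin> P"
  proof
    assume "2 *\<^sub>R q - p \<in> P"
    then have "2 *\<^sub>R q - p = q" using cp closest_point_self by metis
    then show False using \<open>p \<noteq> q\<close> by (simp add: scaleR_2)
  qed
  have "t \<noteq> 0" using \<open>p \<noteq> q\<close> t by auto
  show "L = range (\<lambda>s. q + s *\<^sub>R (p - q))"
  proof (intro set_eqI iffI)
    fix y assume "y \<in> L"
    then obtain r where "y = q + r *\<^sub>R u" using L by blast
    then have "y = q + (r / t) *\<^sub>R (p - q)" using t \<open>t \<noteq> 0\<close> by simp
    then show "y \<in> range (\<lambda>s. q + s *\<^sub>R (p - q))" by blast
  next
    fix y assume "y \<in> range (\<lambda>s. q + s *\<^sub>R (p - q))"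
    then obtain s where "y = q + s *\<^sub>R (p - q)" by blast
    then have "y = q + (s * t) *\<^sub>R u" using t by simp
    then show "y \<in> L" unfolding L by blast
  qed
qed

text \<open>The points of the dilate that the reflection carries from outside into \<open>P\<close>, sorted by the face that
  carries their nearest point. These cells are disjoint and the reflection is injective on each of them; their images
  cover \<open>p\<close> at least as often as there are normals through \<open>p\<close>.\<close>

definition overlap_cell :: "'a::euclidean_space set \<Rightarrow> 'a set \<Rightarrow> 'a set" where
  "overlap_cell P F =
     {x \<in> (\<lambda>x. 3 *\<^sub>R x) ` P - P. closest_point P x \<in> rel_interior F \<and> reflect_nearest P x \<in> P}"

text \<open>Sending a normal at \<open>q\<close> to the face that contains \<open>q\<close> in its relative interior is injective, since
  \<open>2 q - p\<close> is the only point of the cell of that face with image \<open>p\<close>. Symmetry places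
  \<open>2 q - p = 3 ((2/3) q + (1/3) (-p))\<close> in the dilate.\<close>

lemma num_normals_le_cells:
  fixes P :: "'a::euclidean_space set"
  assumes P: "polytope P" and sym: "P = uminus ` P" and p: "p \<in> interior P"
  shows "num_normals P p \<le>
    (\<Sum>F\<in>{F. F face_of P}. indicator (reflect_nearest P ` overlap_cell P F) p)"
proof -
  have cvx: "convex P" and cl: "closed P"
    using P by (auto simp: polytope_imp_convex polytope_imp_closed)
  define \<phi> where "\<phi> q = (SOME F. F face_of P \<and> q \<in> rel_interior F)" for q
  have \<phi>: "\<phi> q face_of P \<and> q \<in> rel_interior (\<phi> q)" if "q \<in> P" for q
    unfolding \<phi>_def by (rule someI_ex) (use rel_interior_face_cover[OF P that] in blast)
  define N where "N = normals_through P p"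
  define \<G> where "\<G> = {F \<in> {F. F face_of P}. p \<in> reflect_nearest P ` overlap_cell P F}"
  have fin: "finite {F. F face_of P}" by (rule finite_polytope_faces[OF P])
  then have finG: "finite \<G>" by (simp add: \<G>_def)
  have key: "q \<in> P" "closest_point P (2 *\<^sub>R q - p) = q" "2 *\<^sub>R q - p \<notin> P"
     "L = range (\<lambda>s. q + s *\<^sub>R (p - q))" if "(q, L) \<in> N" for q L
    using normals_through_nearest[OF cvx cl p] that unfolding N_def by blast+
  have T: "reflect_nearest P (2 *\<^sub>R q - p) = p" if "(q, L) \<in> N" for q L
    using key(2)[OF that] by (simp add: reflect_nearest_def)
  have cell: "2 *\<^sub>R q - p \<in> overlap_cell P (\<phi> q)" if "(q, L) \<in> N" for q L
  proof -
    have "p \<in> P" using p interior_subset by blast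
    then have "- p \<in> P" using sym by (metis imageI)
    have "2 *\<^sub>R q - p = 3 *\<^sub>R ((2/3) *\<^sub>R q + (1/3) *\<^sub>R (- p))"
      by (simp add: algebra_simps)
    moreover have "(2/3) *\<^sub>R q + (1/3) *\<^sub>R (- p) \<in> P"
      using cvx key(1)[OF that] \<open>- p \<in> P\<close> by (rule convexD) auto
    ultimately have "2 *\<^sub>R q - p \<in> (\<lambda>x. 3 *\<^sub>R x) ` P" by (metis imageI)
    then show ?thesis
      using key(1-3)[OF that] T[OF that] \<phi> \<open>p \<in> P\<close> by (auto simp: overlap_cell_def)
  qed
  have inj: "inj_on (\<lambda>(q, L). \<phi> q) N"
  proof (rule inj_onI, clarify)
    fix q L q' L' assume qL: "(q, L) \<in> N" and qL': "(q', L') \<in> N" and eq: "\<phi> q = \<phi> q'"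
    have "2 *\<^sub>R q - p = 2 *\<^sub>R q' - p"
    proof (rule inj_onD[OF reflect_nearest_inj_on_cell[OF cvx cl]])
      show "\<phi> q face_of P" using \<phi> key(1)[OF qL] by blast
    qed (use T[OF qL] T[OF qL'] cell[OF qL] cell[OF qL'] eq in \<open>auto simp: overlap_cell_def\<close>)
    then have "q = q'" by simp
    then show "q = q' \<and> L = L'" using key(4)[OF qL] key(4)[OF qL'] by simp
  qed
  have img: "(\<lambda>(q, L). \<phi> q) ` N \<subseteq> \<G>"
  proof clarify
    fix q L assume qL: "(q, L) \<in> N"
    have "p \<in> reflect_nearest P ` overlap_cell P (\<phi> q)"
      using cell[OF qL] T[OF qL] by (metis imageI)
    then show "\<phi> q \<in> \<G>"
      using \<phi> key(1)[OF qL] by (auto simp: \<G>_def)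
  qed
  have "finite N" using inj_on_finite[OF inj img finG] .
  have "num_normals P p = of_nat (card N)"
    unfolding num_normals_def N_def[symmetric] using \<open>finite N\<close> by simp
  also have "\<dots> \<le> of_nat (card \<G>)"
    using card_inj_on_le[OF inj img finG] by simp
  also have "(of_nat (card \<G>) :: ennreal) = (\<Sum>F\<in>\<G>. 1)" by simp
  also have "\<dots> = (\<Sum>F\<in>{F. F face_of P}. indicator (reflect_nearest P ` overlap_cell P F) p)"
    unfolding \<G>_def using fin by (subst sum.inter_filter) (auto intro!: sum.cong)
  finally show ?thesis .
qed

lemma continuous_on_reflect_nearest:
  fixes P :: "'a::euclidean_space set"
  assumes "convex P" "closed P" "P \<noteq> {}"
  shows "continuous_on A (reflect_nearest P)"
  unfolding reflect_nearest_def
  by (intro continuous_intros continuous_on_closest_point assms)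

lemma overlap_cell_lebesgue:
  fixes P :: "'a::euclidean_space set"
  assumes P: "polytope P" and ne: "P \<noteq> {}" and F: "F face_of P"
  shows "overlap_cell P F \<in> sets lebesgue"
proof -
  have cvx: "convex P" and cl: "closed P" and co: "compact P"
    using P by (auto simp: polytope_imp_convex polytope_imp_closed polytope_imp_compact)
  have "closed F" "bounded F" "convex F"
    using face_of_imp_compact[OF cvx co F] face_of_imp_convex[OF F]
    by (auto simp: compact_eq_bounded_closed)
  have "rel_interior F = F - rel_frontier F"
    using \<open>closed F\<close> rel_interior_subset by (auto simp: rel_frontier_def)
  moreover have "closed (rel_frontier F)"
    using \<open>bounded F\<close> compact_rel_frontier_bounded compact_imp_closed by blast
  ultimately have [measurable]: "rel_interior F \<in> sets borel"
    using \<open>closed F\<close> by auto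
  have [measurable]: "closest_point P \<in> borel_measurable borel"
    using cvx cl ne by (intro borel_measurable_continuous_onI continuous_on_closest_point)
  have [measurable]: "reflect_nearest P \<in> borel_measurable borel"
    using cvx cl ne by (intro borel_measurable_continuous_onI continuous_on_reflect_nearest)
  have [measurable]: "P \<in> sets borel" "(\<lambda>x. 3 *\<^sub>R x) ` P \<in> sets borel"
    using cl co compact_scaling[of P 3] by (auto intro: borel_closed borel_compact)
  have "{x \<in> space borel. x \<in> (\<lambda>x. 3 *\<^sub>R x) ` P - P \<and>
      closest_point P x \<in> rel_interior F \<and> reflect_nearest P x \<in> P} \<in> sets borel"
    by measurable
  then show ?thesis
    by (auto simp: overlap_cell_def conj_commute)
qed

text \<open>The cells together with \<open>P\<close> itself fill only the part of \<open>3 P\<close> that the reflection maps into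
  \<open>P\<close>. The hypothesis on the average says that this part has the full volume of \<open>3 P\<close>. A point of
  \<open>3 P\<close> with image outside \<open>P\<close> would, by continuity, lead to an open set of such points.\<close>

theorem reflect_nearest_dilate_subset:
  fixes P :: "'a::euclidean_space set"
  assumes P: "polytope P" and int: "interior P \<noteq> {}" and sym: "P = uminus ` P"
    and avg: "avg_normals P = 3 ^ DIM('a) - 1"
    and x: "x \<in> (\<lambda>x. 3 *\<^sub>R x) ` P"
  shows "reflect_nearest P x \<in> P"
proof (rule ccontr)
  assume out: "reflect_nearest P x \<notin> P"
  define T where "T = reflect_nearest P"
  define S where "S = (\<lambda>x. 3 *\<^sub>R x) ` P"
  define V where "V = emeasure lebesgue P"
  have cvx: "convex P" and cl: "closed P" and co: "compact P" and ne: "P \<noteq> {}"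
    using P int by (auto simp: polytope_imp_convex polytope_imp_closed polytope_imp_compact)
  have P_meas: "P \<in> lmeasurable" by (rule lmeasurable_compact[OF co])
  have "compact S" unfolding S_def using co by (rule compact_scaling)
  then have S_meas: "S \<in> lmeasurable" by (rule lmeasurable_compact)
  have "0 \<in> P"
  proof -
    obtain z where "z \<in> P" using ne by blast
    moreover from this have "- z \<in> P" using sym by (metis imageI)
    ultimately have "(1/2) *\<^sub>R z + (1/2) *\<^sub>R (- z) \<in> P" using cvx by (intro convexD) auto
    then show ?thesis by simp
  qed
  have PS: "P \<subseteq> S"
  proof
    fix z assume "z \<in> P"
    then have "(1/3) *\<^sub>R z + (2/3) *\<^sub>R 0 \<in> P" using cvx \<open>0 \<in> P\<close> by (intro convexD) auto
    then show "z \<in> S"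
      unfolding S_def using imageI[of "(1/3) *\<^sub>R z" P "\<lambda>x. 3 *\<^sub>R x"] by simp
  qed
  have Tid: "T z = z" if "z \<in> P" for z
    using that by (simp add: T_def reflect_nearest_def closest_point_self scaleR_2)
  have contT: "continuous_on UNIV T"
    unfolding T_def by (rule continuous_on_reflect_nearest[OF cvx cl ne])
  have V0: "V \<noteq> 0"
  proof
    assume "V = 0"
    then have "negligible P"
      using P_meas by (simp add: V_def negligible_iff_emeasure0 fmeasurableD)
    then show False
      using int negligible_subset[OF _ interior_subset] open_not_negligible[OF open_interior] by blast
  qed
  have Vfin: "V \<noteq> \<infinity>" using P_meas by (auto simp: V_def fmeasurable_def)
  have "avg_normals P * V = normals_integral P"
    unfolding avg_normals_def V_def[symmetric] using V0 Vfin
    by (simp add: ennreal_divide_times mult_divide_eq_ennreal top.not_eq_extremum)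
  then have I: "normals_integral P = (3 ^ DIM('a) - 1) * V" using avg by simp
  have "(1::ennreal) \<le> 3 ^ DIM('a)" by (rule one_le_power) simp
  then have total: "normals_integral P + V = 3 ^ DIM('a) * V"
    unfolding I by (metis diff_add_cancel_ennreal distrib_right mult_1)
  have SV: "emeasure lebesgue S = 3 ^ DIM('a) * V"
    using emeasure_lebesgue_affine[of 3 0 P]
    by (simp add: S_def V_def flip: ennreal_power)
  define \<F> where "\<F> = {F. F face_of P}"
  have fin: "finite \<F>" unfolding \<F>_def by (rule finite_polytope_faces[OF P])
  have D_meas: "overlap_cell P F \<in> sets lebesgue" if "F \<in> \<F>" for F
    using overlap_cell_lebesgue[OF P ne] that by (simp add: \<F>_def)
  have lip: "dist (T y) (T z) \<le> dist y z" for y z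
    unfolding T_def by (rule reflect_nearest_nonexpansive[OF cvx cl ne])
  have TD_meas: "T ` overlap_cell P F \<in> sets lebesgue" if "F \<in> \<F>" for F
    by (rule emeasure_nonexpansive_image_le(1)[OF lip D_meas[OF that]])
  have "AE p in lebesgue. p \<notin> frontier P"
    using negligible_convex_frontier[OF cvx]
    by (intro AE_not_in) (simp add: negligible_iff_null_sets)
  then have "AE p in lebesgue. num_normals P p * indicator P p
      \<le> (\<Sum>F\<in>\<F>. indicator (T ` overlap_cell P F) p)"
  proof eventually_elim
    case (elim p)
    show ?case
    proof (cases "p \<in> P")
      case True
      then have "p \<in> interior P" using elim closure_subset by (auto simp: frontier_def)
      then show ?thesis
        using num_normals_le_cells[OF P sym] True by (simp add: T_def \<F>_def)
    qed simp
  qed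
  then have "normals_integral P \<le> (\<integral>\<^sup>+p. (\<Sum>F\<in>\<F>. indicator (T ` overlap_cell P F) p) \<partial>lebesgue)"
    unfolding normals_integral_def by (rule nn_integral_mono_AE)
  also have "\<dots> = (\<Sum>F\<in>\<F>. \<integral>\<^sup>+p. indicator (T ` overlap_cell P F) p \<partial>lebesgue)"
    using TD_meas by (intro nn_integral_sum) auto
  also have "\<dots> = (\<Sum>F\<in>\<F>. emeasure lebesgue (T ` overlap_cell P F))"
    using TD_meas by (intro sum.cong) auto
  also have "\<dots> \<le> (\<Sum>F\<in>\<F>. emeasure lebesgue (overlap_cell P F))"
    by (intro sum_mono emeasure_nonexpansive_image_le(2)[OF lip D_meas])
  also have "\<dots> = emeasure lebesgue (\<Union>F\<in>\<F>. overlap_cell P F)"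
  proof (rule sum_emeasure)
    show "disjoint_family_on (overlap_cell P) \<F>"
      unfolding disjoint_family_on_def overlap_cell_def \<F>_def
      using face_of_eq[of _ P] by fastforce
  qed (use D_meas fin in auto)
  finally have "normals_integral P + V
      \<le> emeasure lebesgue (\<Union>F\<in>\<F>. overlap_cell P F) + emeasure lebesgue P"
    unfolding V_def by (rule add_right_mono)
  also have "\<dots> = emeasure lebesgue ((\<Union>F\<in>\<F>. overlap_cell P F) \<union> P)"
    using fin D_meas P_meas
    by (intro plus_emeasure) (auto simp: overlap_cell_def fmeasurableD)
  also have "\<dots> \<le> emeasure lebesgue (S - interior S \<inter> (T -` (- P)))"
  proof (rule emeasure_mono)
    show "(\<Union>F\<in>\<F>. overlap_cell P F) \<union> P \<subseteq> S - interior S \<inter> (T -` (- P))"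
      using PS Tid by (auto simp: overlap_cell_def S_def T_def)
    have "open (T -` (- P))" using contT cl by (intro open_vimage) auto
    then show "S - interior S \<inter> (T -` (- P)) \<in> sets lebesgue"
      using S_meas by (intro sets.Diff) (auto simp: fmeasurableD)
  qed
  finally have le: "emeasure lebesgue S \<le> emeasure lebesgue (S - interior S \<inter> (T -` (- P)))"
    using total SV by simp
  \<comment> \<open>the interior points of the dilate that are reflected to a point outside P; a nonempty open set because of x\<close>
  define W where "W = interior S \<inter> (T -` (- P))"
  have opT: "open (T -` (- P))" using contT cl by (intro open_vimage) auto
  then have "open W" unfolding W_def by auto
  have intS: "interior S \<noteq> {}"
    using int PS interior_mono by blast
  have "convex S" unfolding S_def using cvx by (rule convex_scaling)
  then have "S \<subseteq> closure (interior S)"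
    using intS closure_subset by (metis convex_closure_interior)
  then have "x \<in> closure (interior S)" using x S_def by blast
  moreover have "x \<in> T -` (- P)" using out by (simp add: T_def)
  ultimately have "W \<noteq> {}"
    unfolding W_def using opT by (metis Int_commute disjoint_iff open_Int_closure_eq_empty)
  then have "\<not> negligible W" using \<open>open W\<close> open_not_negligible by blast
  then have W0: "emeasure lebesgue W \<noteq> 0"
    using \<open>open W\<close> by (simp add: negligible_iff_emeasure0)
  have "W \<subseteq> S" using interior_subset W_def by blast
  have "emeasure lebesgue S + emeasure lebesgue W \<le> emeasure lebesgue (S - W) + emeasure lebesgue W"
    using le unfolding W_def by (rule add_right_mono)
  also have "\<dots> = emeasure lebesgue ((S - W) \<union> W)"
    using \<open>open W\<close> S_meas by (intro plus_emeasure) (auto simp: fmeasurableD)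
  also have "(S - W) \<union> W = S" using \<open>W \<subseteq> S\<close> by blast
  finally have "emeasure lebesgue S + emeasure lebesgue W \<le> emeasure lebesgue S + 0" by simp
  then have "emeasure lebesgue S = \<infinity> \<or> emeasure lebesgue W \<le> 0"
    by (simp only: ennreal_add_left_cancel_le infinity_ennreal_def)
  then show False using W0 S_meas by (auto simp: fmeasurable_def)
qed

section \<open>Perpendicular feet and symmetry of faces\<close>

text \<open>These are exactly the consequences of the extremal average from which the geometry of \<open>P\<close> is derived.\<close>

locale reflecting_polytope =
  fixes P :: "'a::euclidean_space set"
  assumes polytope: "polytope P"
    and sym: "x \<in> P \<Longrightarrow> - x \<in> P"
    and reflect: "x \<in> P \<Longrightarrow> reflect_nearest P (3 *\<^sub>R x) \<in> P"
begin

lemma convex: "convex P" and closed: "closed P"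
  using polytope by (auto simp: polytope_imp_convex polytope_imp_closed)

text \<open>The point \<open>f\<close> is the foot of the perpendicular from the origin to the affine hull of \<open>G\<close>, with the
  requirement that it belongs to \<open>G\<close> itself.\<close>

definition foot_of :: "'a \<Rightarrow> 'a set \<Rightarrow> bool" where
  "foot_of f G \<longleftrightarrow> f \<in> G \<and> (\<forall>x\<in>G. f \<bullet> (x - f) = 0)"

text \<open>With \<open>r\<close> the nearest point of \<open>3 g\<close>, the point \<open>g\<close> is a convex combination of the points \<open>r\<close> and
  \<open>3 g - 2 r\<close> of \<open>P\<close>; a face that contains \<open>g\<close> contains both.\<close>

lemma nearest_and_reflected_in_face:
  assumes G: "G face_of P" and g: "g \<in> G"
  shows "closest_point P (3 *\<^sub>R g) \<in> G"
    and "3 *\<^sub>R g - 2 *\<^sub>R closest_point P (3 *\<^sub>R g) \<in> G"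
proof -
  define r where "r = closest_point P (3 *\<^sub>R g)"
  define y where "y = 3 *\<^sub>R g - 2 *\<^sub>R r"
  have gP: "g \<in> P" using G g face_of_imp_subset by blast
  then have "r \<in> P" unfolding r_def using closed closest_point_in_set by blast
  have "- reflect_nearest P (3 *\<^sub>R g) \<in> P" using sym reflect gP by blast
  then have "y \<in> P" by (simp add: reflect_nearest_def y_def r_def)
  have g_eq: "g = (2/3) *\<^sub>R r + (1/3) *\<^sub>R y" by (simp add: y_def algebra_simps)
  have "r \<in> G \<and> y \<in> G"
  proof (cases "r = y")
    case True
    then have "g = r" using g_eq by (simp flip: scaleR_add_left)
    then show ?thesis using g True by simp
  next
    case False
    then have "g \<in> open_segment r y"
      unfolding in_segment g_eq by (intro conjI exI[of _ "1/3"]) auto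
    then show ?thesis
      using face_ofD[OF G _ \<open>r \<in> P\<close> \<open>y \<in> P\<close> g] by blast
  qed
  then show "closest_point P (3 *\<^sub>R g) \<in> G" "3 *\<^sub>R g - 2 *\<^sub>R closest_point P (3 *\<^sub>R g) \<in> G"
    by (auto simp: r_def y_def)
qed

text \<open>The point \<open>g = (2/3) f + (1/3) z\<close> lies in \<open>G\<close> and \<open>3 g = 2 f + z\<close>, so the nearest point lies in \<open>G\<close>,
  and within \<open>G\<close> the translation by \<open>2 f\<close>, orthogonal to \<open>G\<close>, cannot move the nearest point away
  from \<open>z\<close>.\<close>

lemma nearest_of_foot_translate:
  assumes G: "G face_of P" and f: "foot_of f G" and z: "z \<in> G"
  shows "closest_point P (2 *\<^sub>R f + z) = z"
proof -
  define g where "g = (2/3) *\<^sub>R f + (1/3) *\<^sub>R z"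
  have "f \<in> G" using f by (simp add: foot_of_def)
  then have "g \<in> G"
    unfolding g_def using face_of_imp_convex[OF G] z by (intro convexD) auto
  define r where "r = closest_point P (3 *\<^sub>R g)"
  have "r \<in> G" unfolding r_def by (rule nearest_and_reflected_in_face(1)[OF G \<open>g \<in> G\<close>])
  have zP: "z \<in> P" using G z face_of_imp_subset by blast
  have g3: "3 *\<^sub>R g = 2 *\<^sub>R f + z" by (simp add: g_def algebra_simps)
  have "(2 *\<^sub>R f + z - r) \<bullet> (z - r) \<le> 0"
    unfolding r_def g3[symmetric] by (rule closest_point_dot[OF convex closed zP])
  moreover have "f \<bullet> (z - f) = 0" "f \<bullet> (r - f) = 0"
    using f z \<open>r \<in> G\<close> by (auto simp: foot_of_def)
  ultimately have "(z - r) \<bullet> (z - r) \<le> 0"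
    by (simp add: inner_diff_left inner_diff_right inner_add_left)
  then have "r = z"
    by (metis inner_eq_zero_iff inner_ge_zero order_antisym right_minus_eq)
  then show ?thesis by (simp add: r_def g3)
qed

lemma face_symmetric_about_foot:
  assumes G: "G face_of P" and f: "foot_of f G" and z: "z \<in> G"
  shows "2 *\<^sub>R f - z \<in> G"
proof -
  define g where "g = (2/3) *\<^sub>R f + (1/3) *\<^sub>R z"
  have "f \<in> G" using f by (simp add: foot_of_def)
  then have "g \<in> G"
    unfolding g_def using face_of_imp_convex[OF G] z by (intro convexD) auto
  have g3: "3 *\<^sub>R g = 2 *\<^sub>R f + z" by (simp add: g_def algebra_simps)
  have "3 *\<^sub>R g - 2 *\<^sub>R closest_point P (3 *\<^sub>R g) \<in> G"
    by (rule nearest_and_reflected_in_face(2)[OF G \<open>g \<in> G\<close>])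
  then show ?thesis
    unfolding g3 nearest_of_foot_translate[OF assms] by (simp add: scaleR_2)
qed

lemma foot_is_outer_normal:
  assumes G: "G face_of P" and f: "foot_of f G" and x: "x \<in> P"
  shows "f \<bullet> (x - f) \<le> 0"
proof -
  have "closest_point P (2 *\<^sub>R f + f) = f"
    using nearest_of_foot_translate[OF G f] f by (simp add: foot_of_def)
  then show ?thesis
    using closest_point_dot[OF convex closed x, of "2 *\<^sub>R f + f"] by simp
qed

text \<open>Suppose that the foot \<open>f0\<close> of the perpendicular from the origin to the affine hull were outside \<open>G\<close>.
  On the way from the relative interior to \<open>f0\<close> one leaves \<open>G\<close> through a proper face \<open>K\<close>. By induction \<open>K\<close> has a foot \<open>k\<close>, which is an outer
  normal of \<open>P\<close> along \<open>K\<close>, so \<open>f0\<close> would have to lie on the outer side of the hyperplane through \<open>K\<close>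
  with normal \<open>k\<close>. But \<open>f0\<close> is the point of the affine hull closest to the origin, hence on the inner
  side of it.\<close>

lemma face_has_foot:
  assumes "G face_of P" "G \<noteq> {}"
  shows "\<exists>f. foot_of f G"
  using assms
proof (induction "nat (aff_dim G)" arbitrary: G rule: less_induct)
  case less
  have G: "G face_of P" "G \<noteq> {}" by fact+
  have GP: "G \<subseteq> P" using G(1) face_of_imp_subset by blast
  have polG: "polytope G" using polytope G(1) face_of_polytope_polytope by blast
  have cvG: "convex G" using polG polytope_imp_convex by blast
  define f0 where "f0 = closest_point (affine hull G) 0"
  have f0_aff: "f0 \<in> affine hull G"
    unfolding f0_def using G(2) by (intro closest_point_in_set) auto
  have f0_orth: "f0 \<bullet> (x - f0) = 0" if "x \<in> affine hull G" for x
  proof -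
    have le: "- f0 \<bullet> (y - f0) \<le> 0" if "y \<in> affine hull G" for y
      using closest_point_dot[OF _ _ that, of 0] affine_imp_convex[of "affine hull G"]
      by (simp add: f0_def)
    have "2 *\<^sub>R f0 - x \<in> affine hull G"
      using mem_affine[OF affine_affine_hull f0_aff that, of 2 "-1"] by (simp add: scaleR_minus_left)
    from le[OF this] le[OF that] show ?thesis
      by (simp add: inner_diff_right algebra_simps scaleR_2 inner_add_right)
  qed
  show ?case
  proof (cases "f0 \<in> G")
    case True
    then show ?thesis using f0_orth hull_inc unfolding foot_of_def by metis
  next
    case False
    obtain z where z: "z \<in> rel_interior G"
      using G(2) cvG rel_interior_eq_empty by blast
    then have zG: "z \<in> G" using rel_interior_subset by blast
    then have "z \<noteq> f0" using False by blast
    obtain d where d: "0 < d" "z + d *\<^sub>R (f0 - z) \<in> rel_frontier G"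
        and di: "\<And>e. \<lbrakk>0 \<le> e; e < d\<rbrakk> \<Longrightarrow> z + e *\<^sub>R (f0 - z) \<in> rel_interior G"
      by (rule ray_to_rel_frontier[of G z "f0 - z"])
        (use polG z f0_aff \<open>z \<noteq> f0\<close> in \<open>auto simp: polytope_imp_bounded\<close>)
    have "d \<le> 1"
    proof (rule ccontr)
      assume "\<not> d \<le> 1"
      then have "z + 1 *\<^sub>R (f0 - z) \<in> rel_interior G" using di[of 1] by simp
      then show False using False rel_interior_subset by auto
    qed
    define t where "t = z + d *\<^sub>R (f0 - z)"
    obtain K where K: "K face_of G" "K \<noteq> G" "t \<in> K"
      using d(2) rel_frontier_of_polyhedron_alt[OF polytope_imp_polyhedron[OF polG]]
      unfolding t_def by blast
    have KP: "K face_of P" using K(1) G(1) face_of_trans by blast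
    have "aff_dim K < aff_dim G" using face_of_aff_dim_lt[OF cvG K(1,2)] .
    moreover have "aff_dim K \<ge> 0"
      using aff_dim_geq[of K] aff_dim_empty[of K] K(3) by force
    ultimately have "nat (aff_dim K) < nat (aff_dim G)" by linarith
    then obtain k where k: "foot_of k K" using less.hyps KP K(3) by blast
    have kK: "k \<in> K" using k by (simp add: foot_of_def)
    then have kG: "k \<in> G" using K(1) face_of_imp_subset by blast
    have kle: "k \<bullet> (x - k) \<le> 0" if "x \<in> P" for x
      by (rule foot_is_outer_normal[OF KP k that])
    have kt: "k \<bullet> (t - k) = 0" using k K(3) by (simp add: foot_of_def)
    have f0k: "k \<bullet> (f0 - k) \<le> 0"
    proof -
      have "f0 \<bullet> (k - f0) = 0" using f0_orth kG hull_inc by metis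
      then have "k \<bullet> (f0 - k) = - ((k - f0) \<bullet> (k - f0))"
        by (simp add: inner_diff_left inner_diff_right inner_commute)
      then show ?thesis using inner_ge_zero[of "k - f0"] by linarith
    qed
    have "(1 - d) * (k \<bullet> (z - k)) + d * (k \<bullet> (f0 - k)) = k \<bullet> (t - k)"
      by (simp add: t_def inner_diff_right inner_add_right algebra_simps)
    moreover have "(1 - d) * (k \<bullet> (z - k)) \<le> 0" "d * (k \<bullet> (f0 - k)) \<le> 0"
      using \<open>d \<le> 1\<close> d(1) f0k kle zG GP by (auto intro!: mult_nonneg_nonpos)
    ultimately have "(1 - d) * (k \<bullet> (z - k)) = 0" "d * (k \<bullet> (f0 - k)) = 0"
      using kt by linarith+
    then have "k \<bullet> (f0 - k) = 0" using d(1) by simp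
    then have "f0 = k"
    proof -
      have "f0 \<bullet> (k - f0) = 0" using f0_orth kG hull_inc by metis
      then have "(k - f0) \<bullet> (k - f0) = 0"
        using \<open>k \<bullet> (f0 - k) = 0\<close> by (simp add: inner_diff_left inner_diff_right inner_commute)
      then show ?thesis by simp
    qed
    then show ?thesis using False kG by blast
  qed
qed


text \<open>Symmetry about the foot places the foot at the midpoint of the edge.\<close>

lemma edge_ends_equidistant:
  assumes E: "closed_segment a b face_of P"
  shows "norm a = norm b"
proof (cases "a = b")
  case False
  obtain f where f: "foot_of f (closed_segment a b)"
    using face_has_foot[OF E] by auto
  then obtain t where t: "0 \<le> t" "t \<le> 1" "f = (1 - t) *\<^sub>R a + t *\<^sub>R b"
    unfolding foot_of_def in_segment by blast
  have coord: "0 \<le> s \<and> s \<le> 1" if in_s: "a + s *\<^sub>R (b - a) \<in> closed_segment a b" for s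
  proof -
    obtain r where r: "0 \<le> r" "r \<le> 1" "a + s *\<^sub>R (b - a) = (1 - r) *\<^sub>R a + r *\<^sub>R b"
      using in_s unfolding in_segment by blast
    then have "(s - r) *\<^sub>R (b - a) = 0" by (simp add: algebra_simps)
    then show ?thesis using False r by simp
  qed
  have "2 *\<^sub>R f - a = a + (2 * t) *\<^sub>R (b - a)" "2 *\<^sub>R f - b = a + (2 * t - 1) *\<^sub>R (b - a)"
    unfolding t(3) by (simp_all add: algebra_simps flip: scaleR_2)
  then have "0 \<le> 2 * t \<and> 2 * t \<le> 1" "0 \<le> 2 * t - 1 \<and> 2 * t - 1 \<le> 1"
    using face_symmetric_about_foot[OF E f, of a] face_symmetric_about_foot[OF E f, of b]
      coord[of "2 * t"] coord[of "2 * t - 1"]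
    by simp_all
  then have "t = 1/2" by linarith
  then have f_eq: "f = (1/2) *\<^sub>R (a + b)" 
    unfolding t(3) by (simp only: \<open>t = 1/2\<close>) (simp add: algebra_simps)
  have "f \<bullet> (a - f) = 0" "f \<bullet> (b - f) = 0" using f by (auto simp: foot_of_def)
  then have "(a + b) \<bullet> (a - b) = 0"
    by (simp add: f_eq inner_diff_right)
  then have "a \<bullet> a = b \<bullet> b"
    by (simp add: inner_diff_left inner_diff_right inner_add_left inner_add_right inner_commute)
  then show ?thesis by (simp add: norm_eq_sqrt_inner)
qed simp

text \<open>A coordinate is nonnegative because the functional that exposes the other edge is negative on the
  edge vector belonging to this coordinate.\<close>

lemma polygon_face_corner_coordinates:
  assumes G: "polytope G" "aff_dim G = 2"
    and ba: "closed_segment b a edge_of G" and bc: "closed_segment b c edge_of G" and "a \<noteq> c"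
    and x: "x \<in> G"
  shows "\<exists>l m. 0 \<le> l \<and> 0 \<le> m \<and> x - b = l *\<^sub>R (a - b) + m *\<^sub>R (c - b)"
proof -
  have faces: "closed_segment b a face_of G" "closed_segment b c face_of G"
    and "b \<noteq> a" "b \<noteq> c"
    using ba bc by (auto simp: edge_of_def)
  have ext: "b extreme_point_of G" "a extreme_point_of G" "c extreme_point_of G"
    using segment_face_of faces by blast+
  then have inG: "a \<in> G" "b \<in> G" "c \<in> G" by (auto simp: extreme_point_of_def)
  have nb: "\<not> between (p, q) r" if "r extreme_point_of G" "p \<in> G" "q \<in> G" "r \<noteq> p" "r \<noteq> q" for p q r
    using that unfolding between_mem_segment extreme_point_of_def open_segment_def by blast
  have "\<not> collinear {a, b, c}"
    using collinear_between_cases nb ext inG \<open>a \<noteq> c\<close> \<open>b \<noteq> a\<close> \<open>b \<noteq> c\<close> by metis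
  then have ind: "\<not> affine_dependent {a, b, c}"
    by (simp add: collinear_3_eq_affine_dependent)
  have "aff_dim {a, b, c} = 2"
    using aff_dim_affine_independent[OF ind] \<open>a \<noteq> c\<close> \<open>b \<noteq> a\<close> \<open>b \<noteq> c\<close> by auto
  then have "affine hull {a, b, c} = affine hull G"
    using G(2) inG by (intro aff_dim_eq_full_gen[THEN iffD1]) auto
  then have "x \<in> affine hull {a, b, c}" using x hull_inc by metis
  then obtain u v w where uvw: "x = u *\<^sub>R a + v *\<^sub>R b + w *\<^sub>R c" "u + v + w = 1"
    unfolding affine_hull_3 by blast
  then have v: "v = 1 - u - w" by simp
  have x_eq: "x - b = u *\<^sub>R (a - b) + w *\<^sub>R (c - b)"
    unfolding uvw(1) v by (simp add: algebra_simps)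
  have nonneg: "0 \<le> l" if "closed_segment b q face_of G" "p extreme_point_of G" "p \<noteq> b" "p \<noteq> q"
      "x - b = l *\<^sub>R (p - b) + m *\<^sub>R (q - b)" for p q l m
  proof -
    have "closed_segment b q exposed_face_of G"
      using that(1) G(1) exposed_face_of_polyhedron polytope_imp_polyhedron by blast
    then obtain n h where nh: "G \<subseteq> {x. n \<bullet> x \<le> h}" "closed_segment b q = G \<inter> {x. n \<bullet> x = h}"
      by (auto simp: exposed_face_of_def)
    have bq: "n \<bullet> b = h" "n \<bullet> q = h" "b \<in> G" "q \<in> G" using nh(2) by auto
    have "p \<in> G" using that(2) by (simp add: extreme_point_of_def)
    have "p \<notin> closed_segment b q"
      using nb[OF that(2) bq(3,4) that(3,4)] by (simp add: between_mem_segment)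
    then have "n \<bullet> (p - b) < 0"
      using nh \<open>p \<in> G\<close> bq(1) by (force simp: inner_diff_right)
    moreover have "n \<bullet> (x - b) \<le> 0" using nh(1) x bq(1) by (auto simp: inner_diff_right)
    moreover have "n \<bullet> (x - b) = l * (n \<bullet> (p - b))"
      unfolding that(5) using bq by (simp add: inner_add_right inner_diff_right)
    ultimately show ?thesis by (simp add: mult_le_0_iff)
  qed
  have "0 \<le> u" by (rule nonneg[OF faces(2) ext(2) _ _ x_eq]) (use \<open>b \<noteq> a\<close> \<open>a \<noteq> c\<close> in auto)
  moreover have "0 \<le> w"
    by (rule nonneg[OF faces(1) ext(3), of w u]) (use \<open>b \<noteq> c\<close> \<open>a \<noteq> c\<close> x_eq in \<open>auto simp: add.commute\<close>)
  ultimately show ?thesis using x_eq by blast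
qed

text \<open>Let \<open>a'\<close> be the opposite of \<open>a\<close> in the symmetric polygon. Since \<open>a\<close> and \<open>b\<close> lie on a circle around its
  centre, the theorem of Thales gives a right angle at \<open>b\<close> between \<open>a\<close> and \<open>a'\<close>, and \<open>a'\<close> lies within
  the angle at \<open>b\<close>. The only exception would be \<open>a' = b\<close>, but then the centre would lie on the edge.\<close>

lemma face_angle_not_acute:
  assumes G: "G face_of P" "aff_dim G = 2"
    and ba: "closed_segment b a edge_of G" and bc: "closed_segment b c edge_of G" and "a \<noteq> c"
  shows "(a - b) \<bullet> (c - b) \<le> 0"
proof -
  have polG: "polytope G" using polytope G(1) face_of_polytope_polytope by blast
  have faceE: "closed_segment b a face_of G" and "b \<noteq> a" using ba by (auto simp: edge_of_def)
  then have inG: "a \<in> G" "b \<in> G" using face_of_imp_subset by force+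
  obtain f where f: "foot_of f G" using face_has_foot G(1) inG by blast
  define a' where "a' = 2 *\<^sub>R f - a"
  have a'G: "a' \<in> G" unfolding a'_def by (rule face_symmetric_about_foot[OF G(1) f inG(1)])
  have fab: "f \<bullet> (a - f) = 0" "f \<bullet> (b - f) = 0" using f inG by (auto simp: foot_of_def)
  have "norm b = norm a"
    using edge_ends_equidistant face_of_trans[OF faceE G(1)] by blast
  then have "a \<bullet> a = b \<bullet> b" by (simp add: norm_eq_sqrt_inner)
  then have thales: "(a' - b) \<bullet> (a - b) = 0"
    using fab by (simp add: a'_def inner_diff_left inner_diff_right inner_commute algebra_simps)
  obtain l m where lm: "0 \<le> l" "0 \<le> m" "a' - b = l *\<^sub>R (a - b) + m *\<^sub>R (c - b)"
    using polygon_face_corner_coordinates[OF polG G(2) ba bc \<open>a \<noteq> c\<close> a'G] by blast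
  have expand: "0 = l * ((a - b) \<bullet> (a - b)) + m * ((c - b) \<bullet> (a - b))"
    using thales unfolding lm(3) by (simp add: inner_add_left)
  have aa: "(a - b) \<bullet> (a - b) > 0" using \<open>b \<noteq> a\<close> by simp
  have "m \<noteq> 0"
  proof
    assume "m = 0"
    then have "l = 0" using expand aa by simp
    then have "a' = b" using lm(3) \<open>m = 0\<close> by simp
    then have "2 *\<^sub>R f = a + b" by (simp add: a'_def algebra_simps)
    moreover have "f = (1/2) *\<^sub>R (2 *\<^sub>R f)" by simp
    ultimately have "f = (1 - 1/2) *\<^sub>R b + (1/2) *\<^sub>R a" by (simp add: algebra_simps)
    then have fE: "f \<in> closed_segment b a" unfolding in_segment by (intro exI[of _ "1/2"]) auto
    have "G \<subseteq> closed_segment b a"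
    proof
      fix z assume "z \<in> G"
      show "z \<in> closed_segment b a"
      proof (cases "z = f")
        case False
        then have "f \<in> open_segment z (2 *\<^sub>R f - z)"
          unfolding in_segment
          by (intro conjI exI[of _ "1/2"]) (auto simp: algebra_simps simp flip: scaleR_2)
        then show ?thesis
          using face_ofD[OF faceE _ \<open>z \<in> G\<close> face_symmetric_about_foot[OF G(1) f \<open>z \<in> G\<close>] fE] by blast
      qed (use fE in simp)
    qed
    then have "aff_dim G \<le> aff_dim (closed_segment b a)" by (rule aff_dim_subset)
    then show False using G(2) ba by (simp add: edge_of_def)
  qed
  then have "0 < m" using lm(2) by simp
  moreover have "m * ((c - b) \<bullet> (a - b)) \<le> 0"
    using expand lm(1) aa by (smt (verit) mult_nonneg_nonneg)
  ultimately show ?thesis by (simp add: mult_le_0_iff inner_commute)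
qed

lemma polygon_angle_not_acute:
  assumes G: "G face_of P" "aff_dim G = 2" and "\<theta> \<in> polygon_angles G"
  shows "\<not> \<theta> < pi / 2"
proof -
  obtain a b c where th: "\<theta> = vertex_angle a b c" and "a \<noteq> c"
    and e: "closed_segment b a edge_of G" "closed_segment b c edge_of G"
    using assms(3) by (auto simp: polygon_angles_def)
  define q where "q = ((a - b) \<bullet> (c - b)) / (norm (a - b) * norm (c - b))"
  have "(a - b) \<bullet> (c - b) \<le> 0" by (rule face_angle_not_acute[OF G e \<open>a \<noteq> c\<close>])
  then have "q \<le> 0" unfolding q_def by (simp add: divide_nonpos_nonneg)
  moreover have "- 1 \<le> q"
  proof -
    have "a \<noteq> b" "c \<noteq> b" using e by (auto simp: edge_of_def)
    then have "0 < norm (a - b) * norm (c - b)" by simp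
    moreover have "- (norm (a - b) * norm (c - b)) \<le> (a - b) \<bullet> (c - b)"
      using Cauchy_Schwarz_ineq2[of "a - b" "c - b"] by linarith
    ultimately show ?thesis unfolding q_def by (simp add: pos_le_divide_eq)
  qed
  ultimately have "arccos 0 \<le> arccos q" by (intro arccos_le_arccos) auto
  then show ?thesis unfolding th vertex_angle_def q_def[symmetric] by simp
qed

end

section \<open>Maximal faces and edge vectors\<close>

definition max_face :: "'a::euclidean_space set \<Rightarrow> 'a \<Rightarrow> 'a set" where
  "max_face P u = {x \<in> P. \<forall>y\<in>P. u \<bullet> y \<le> u \<bullet> x}"

text \<open>The vector \<open>e\<close> records both direction and length of an edge; \<open>-e\<close> belongs to the same edge.\<close>

definition has_edge :: "'a::euclidean_space set \<Rightarrow> 'a \<Rightarrow> bool" where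
  "has_edge P e \<longleftrightarrow> e \<noteq> 0 \<and> (\<exists>b. closed_segment b (b + e) face_of P)"

lemma max_face_subset: "max_face P u \<subseteq> P"
  by (auto simp: max_face_def)

lemma max_face_zero [simp]: "max_face P 0 = P"
  by (auto simp: max_face_def)

lemma max_face_nonempty:
  assumes "compact P" "P \<noteq> {}"
  shows "max_face P u \<noteq> {}"
proof -
  have "\<exists>x\<in>P. \<forall>y\<in>P. u \<bullet> y \<le> u \<bullet> x"
    by (intro continuous_attains_sup assms continuous_intros)
  then show ?thesis by (auto simp: max_face_def)
qed

lemma max_face_face_of:
  assumes "convex P"
  shows "max_face P u face_of P"
proof (cases "max_face P u = {}")
  case False
  then obtain x where x: "x \<in> P" "\<And>y. y \<in> P \<Longrightarrow> u \<bullet> y \<le> u \<bullet> x"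
    by (auto simp: max_face_def)
  then have "u \<bullet> y = u \<bullet> x" if "y \<in> max_face P u" for y
    using that by (simp add: max_face_def order_antisym)
  then have "max_face P u = P \<inter> {y. u \<bullet> y = u \<bullet> x}"
    using x(2) by (auto simp: max_face_def)
  then show ?thesis
    using face_of_Int_supporting_hyperplane_le[OF assms x(2)] by simp
qed simp

lemma face_eq_max_face:
  assumes "polytope P" "F face_of P" "F \<noteq> {}"
  obtains u where "F = max_face P u"
proof -
  have "F exposed_face_of P"
    using assms exposed_face_of_polyhedron polytope_imp_polyhedron by blast
  then obtain a b where ab: "P \<subseteq> {x. a \<bullet> x \<le> b}" "F = P \<inter> {x. a \<bullet> x = b}"
    by (auto simp: exposed_face_of_def)
  obtain z where "z \<in> P" "a \<bullet> z = b" using ab(2) assms(3) by blast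
  then have "b \<le> a \<bullet> x" if "x \<in> max_face P a" for x
    using that by (auto simp: max_face_def)
  then have "F = max_face P a"
    using ab by (auto simp: max_face_def intro: order_antisym)
  then show ?thesis by (rule that)
qed

lemma max_face_eq_iterated:
  assumes "max_face P u' \<noteq> {}" "max_face P u' \<subseteq> max_face P u"
  shows "max_face P u' = max_face (max_face P u) u'"
proof -
  obtain z where z: "z \<in> max_face P u'" "z \<in> max_face P u" using assms by blast
  have "y \<in> max_face P u'" if "y \<in> max_face (max_face P u) u'" for y
    using z that by (auto simp: max_face_def intro: order_trans)
  then show ?thesis using assms(2) by (auto simp: max_face_def)
qed

text \<open>For each of the finitely many faces \<open>F\<close>, the functionals that are maximal on all of \<open>F\<close> form a closed
  set. So a neighbourhood of \<open>u\<close> avoids these sets for all \<open>F\<close> not contained in the maximal face for \<open>u\<close>.\<close>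

lemma max_face_locally_shrinks:
  fixes P :: "'a::euclidean_space set"
  assumes P: "polytope P"
  shows "\<exists>\<epsilon>>0. \<forall>u'\<in>ball u \<epsilon>. max_face P u' \<subseteq> max_face P u"
proof -
  define \<B> where "\<B> = {F. F face_of P \<and> \<not> F \<subseteq> max_face P u}"
  have closed: "closed {u'. F \<subseteq> max_face P u'}" if "F \<in> \<B>" for F
  proof -
    have "F \<subseteq> P" using that face_of_imp_subset by (auto simp: \<B>_def)
    then have "{u'. F \<subseteq> max_face P u'} = (\<Inter>x\<in>F. \<Inter>y\<in>P. {u'. u' \<bullet> y \<le> u' \<bullet> x})"
      by (auto simp: max_face_def)
    also have "closed \<dots>"
      by (intro closed_INT ballI closed_Collect_le continuous_intros)
    finally show ?thesis .
  qed
  have "finite \<B>"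
    using finite_polytope_faces[OF P] by (rule rev_finite_subset) (auto simp: \<B>_def)
  then have "closed (\<Union>F\<in>\<B>. {u'. F \<subseteq> max_face P u'})"
    using closed by (intro closed_UN) auto
  then have "open (- (\<Union>F\<in>\<B>. {u'. F \<subseteq> max_face P u'}))" by (rule open_Compl)
  moreover have "u \<in> - (\<Union>F\<in>\<B>. {u'. F \<subseteq> max_face P u'})" by (auto simp: \<B>_def)
  ultimately obtain \<epsilon> where \<epsilon>: "\<epsilon> > 0" "ball u \<epsilon> \<subseteq> - (\<Union>F\<in>\<B>. {u'. F \<subseteq> max_face P u'})"
    by (rule openE)
  have "max_face P u' \<subseteq> max_face P u" if "u' \<in> ball u \<epsilon>" for u'
  proof -
    have "max_face P u' \<notin> \<B>" using \<epsilon>(2) that by blast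
    then show ?thesis
      using max_face_face_of[OF polytope_imp_convex[OF P]] by (auto simp: \<B>_def)
  qed
  then show ?thesis using \<epsilon>(1) by blast
qed

lemma max_face_locally_iterated:
  fixes P :: "'a::euclidean_space set"
  assumes P: "polytope P" "P \<noteq> {}"
  shows "\<exists>\<epsilon>>0. \<forall>u'\<in>ball u \<epsilon>. max_face P u' = max_face (max_face P u) u'"
proof -
  obtain \<epsilon> where "\<epsilon> > 0" and \<epsilon>: "\<And>u'. u' \<in> ball u \<epsilon> \<Longrightarrow> max_face P u' \<subseteq> max_face P u"
    using max_face_locally_shrinks[OF P(1)] by blast
  have "max_face P u' = max_face (max_face P u) u'" if "u' \<in> ball u \<epsilon>" for u'
    using max_face_nonempty[OF polytope_imp_compact[OF P(1)] P(2)] \<epsilon>[OF that]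
    by (rule max_face_eq_iterated)
  then show ?thesis using \<open>\<epsilon> > 0\<close> by blast
qed

lemma max_face_constant:
  assumes "\<And>x y. x \<in> P \<Longrightarrow> y \<in> P \<Longrightarrow> v \<bullet> x = v \<bullet> y"
  shows "max_face P (u + v) = max_face P u"
proof -
  have "(u + v) \<bullet> y \<le> (u + v) \<bullet> x \<longleftrightarrow> u \<bullet> y \<le> u \<bullet> x" if "x \<in> P" "y \<in> P" for x y
    using assms[OF that] by (simp add: inner_add_left)
  then show ?thesis by (auto simp: max_face_def)
qed

lemma max_face_scaleR:
  assumes "k > 0"
  shows "max_face P (k *\<^sub>R u) = max_face P u"
  using assms by (auto simp: max_face_def)

lemma nontrivial_kernel_in_subspace:
  fixes c :: "'a::euclidean_space"
  assumes "dim S \<ge> 2"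
  shows "\<exists>l. l \<in> span S \<and> l \<noteq> 0 \<and> c \<bullet> l = 0"
proof (rule ccontr)
  assume "\<not> ?thesis"
  then have "inj_on ((\<bullet>) c) (span S)"
    by (subst linear_injective_on_subspace_0) (auto intro: bounded_linear.linear bounded_linear_inner_right)
  then have "dim ((\<bullet>) c ` S) = dim S"
    by (intro dim_image_eq) (auto intro: bounded_linear.linear bounded_linear_inner_right)
  moreover have "dim ((\<bullet>) c ` S) \<le> 1"
    using dim_subset_UNIV[of "(\<bullet>) c ` S"] by simp
  ultimately show False using assms by linarith
qed

text \<open>Take a minimal face \<open>F\<close> on which \<open>c\<close> is not constant. If it had dimension two or more, one could
  move from any relative interior point along a level set of \<open>c\<close> to a proper face, on which \<open>c\<close> is
  constant. Then \<open>c\<close> would take only finitely many values on the relative interior of \<open>F\<close>, which is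
  connected. So \<open>F\<close> is an edge.\<close>

lemma nonconstant_on_edge:
  fixes P :: "'a::euclidean_space set"
  assumes P: "polytope P" and xy: "x \<in> P" "y \<in> P" "c \<bullet> x \<noteq> c \<bullet> y"
  shows "\<exists>e. has_edge P e \<and> c \<bullet> e \<noteq> 0"
proof -
  define \<F> where "\<F> = {F. F face_of P \<and> (\<exists>x\<in>F. \<exists>y\<in>F. c \<bullet> x \<noteq> c \<bullet> y)}"
  have "finite \<F>"
    using finite_polytope_faces[OF P] by (rule rev_finite_subset) (auto simp: \<F>_def)
  moreover have "P \<in> \<F>"
    using P xy by (auto simp: \<F>_def face_of_refl_eq polytope_imp_convex)
  ultimately obtain F where F: "F \<in> \<F>" and min: "\<And>G. G \<in> \<F> \<Longrightarrow> G \<subseteq> F \<Longrightarrow> G = F"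
    using finite_has_minimal[of \<F>] by (metis empty_iff)
  have face: "F face_of P" using F by (simp add: \<F>_def)
  obtain x y where xyF: "x \<in> F" "y \<in> F" "c \<bullet> x \<noteq> c \<bullet> y" using F by (auto simp: \<F>_def)
  have polF: "polytope F" using P face face_of_polytope_polytope by blast
  have cvF: "convex F" and coF: "compact F"
    using polF by (auto simp: polytope_imp_convex polytope_imp_compact)
  have const: "c \<bullet> p = c \<bullet> q" if "K face_of F" "K \<noteq> F" "p \<in> K" "q \<in> K" for K p q
    using min[of K] that face face_of_trans face_of_imp_subset unfolding \<F>_def by blast
  have "aff_dim F \<le> 1"
  proof (rule ccontr)
    assume big: "\<not> aff_dim F \<le> 1"
    define \<K> where "\<K> = {K. K face_of F \<and> K \<noteq> F \<and> K \<noteq> {}}"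
    have "finite \<K>"
      using finite_polytope_faces[OF polF] by (rule rev_finite_subset) (auto simp: \<K>_def)
    have sub: "(\<bullet>) c ` rel_interior F \<subseteq> (\<lambda>K. c \<bullet> (SOME p. p \<in> K)) ` \<K>"
    proof clarify
      fix z assume z: "z \<in> rel_interior F"
      then have "z \<in> F" using rel_interior_subset by blast
      then have "dim ((\<lambda>x. x - z) ` F) \<ge> 2"
        using big aff_dim_eq_dim_subtract[of z F] by (simp add: hull_inc)
      then obtain l where l: "l \<in> span ((\<lambda>x. x - z) ` F)" "l \<noteq> 0" "c \<bullet> l = 0"
        using nontrivial_kernel_in_subspace by blast
      have "z + l \<in> affine hull F"
        using l(1) affine_hull_span_gen[OF hull_inc[OF \<open>z \<in> F\<close>]] by simp
      then obtain d where "z + d *\<^sub>R l \<in> rel_frontier F"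
        using ray_to_rel_frontier[of F z l] z l(2) polF polytope_imp_bounded by metis
      then obtain K where K: "K face_of F" "K \<noteq> F" "z + d *\<^sub>R l \<in> K"
        using rel_frontier_of_polyhedron_alt[OF polytope_imp_polyhedron[OF polF]] by blast
      then have "K \<in> \<K>" by (auto simp: \<K>_def)
      have "(SOME p. p \<in> K) \<in> K" using K(3) by (rule someI)
      then have "c \<bullet> (SOME p. p \<in> K) = c \<bullet> (z + d *\<^sub>R l)"
        using const[OF K(1,2) _ K(3)] by blast
      then have "c \<bullet> z = c \<bullet> (SOME p. p \<in> K)" using l(3) by (simp add: inner_add_right)
      then show "c \<bullet> z \<in> (\<lambda>K. c \<bullet> (SOME p. p \<in> K)) ` \<K>" using \<open>K \<in> \<K>\<close> by blast
    qed
    then have fin: "finite ((\<bullet>) c ` rel_interior F)"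
      using \<open>finite \<K>\<close> finite_subset by blast
    have "connected ((\<bullet>) c ` rel_interior F)"
      by (intro connected_continuous_image convex_connected convex_rel_interior cvF continuous_intros)
    then obtain k where "(\<bullet>) c ` rel_interior F \<subseteq> {k}"
      using connected_finite_iff_sing fin by (metis empty_subsetI order_refl)
    then have "rel_interior F \<subseteq> {p. c \<bullet> p = k}" by blast
    then have "closure (rel_interior F) \<subseteq> {p. c \<bullet> p = k}"
      by (rule closure_minimal) (rule closed_hyperplane)
    moreover have "F \<subseteq> closure (rel_interior F)"
      using convex_closure_rel_interior[OF cvF] closure_subset by blast
    ultimately show False using xyF by blast
  qed
  then have "collinear F" by (simp add: collinear_aff_dim)
  then obtain a b where ab: "F = closed_segment a b"
    using compact_convex_collinear_segment[of F] coF cvF xyF by blast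
  have "c \<bullet> (b - a) \<noteq> 0"
  proof
    assume "c \<bullet> (b - a) = 0"
    then have "c \<bullet> p = c \<bullet> a" if "p \<in> F" for p
      using that unfolding ab in_segment by (auto simp: inner_add_right inner_diff_right left_diff_distrib)
    then show False using xyF by metis
  qed
  moreover have "has_edge P (b - a)"
    using face calculation unfolding has_edge_def ab by (auto intro!: exI[of _ a])
  ultimately show ?thesis by blast
qed

lemma has_edge_face:
  assumes "F face_of P" "has_edge F e"
  shows "has_edge P e"
  using assms face_of_trans unfolding has_edge_def by blast

lemma has_edge_max_face_iff:
  assumes "convex P"
  shows "has_edge (max_face P u) e \<longleftrightarrow>
    e \<noteq> 0 \<and> (\<exists>b. closed_segment b (b + e) face_of P \<and> closed_segment b (b + e) \<subseteq> max_face P u)"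
  using face_of_face[OF max_face_face_of[OF assms]] unfolding has_edge_def by blast

definition polygon_faces_symmetric :: "'a::euclidean_space set \<Rightarrow> bool" where
  "polygon_faces_symmetric P \<longleftrightarrow>
     (\<forall>G. G face_of P \<and> aff_dim G = 2 \<longrightarrow> (\<exists>s. \<forall>x\<in>G. s - x \<in> G))"

lemma max_face_opposite:
  assumes "\<And>x. x \<in> P \<Longrightarrow> s - x \<in> P" "x \<in> max_face P u"
  shows "s - x \<in> max_face P (- u)"
proof -
  have "u \<bullet> (s - y) \<le> u \<bullet> x" if "y \<in> P" for y
    using assms that by (simp add: max_face_def)
  then have "- u \<bullet> y \<le> - u \<bullet> (s - x)" if "y \<in> P" for y
    using that by (force simp: inner_diff_right)
  then show ?thesis
    using assms by (simp add: max_face_def)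
qed

lemma has_edge_max_face_opposite:
  fixes P :: "'a::euclidean_space set"
  assumes cv: "convex P" and s: "\<And>x. x \<in> P \<Longrightarrow> s - x \<in> P" and e: "has_edge (max_face P u) e"
  shows "has_edge (max_face P (- u)) e"
proof -
  obtain b where "e \<noteq> 0" and b: "closed_segment b (b + e) face_of P" "closed_segment b (b + e) \<subseteq> max_face P u"
    using e has_edge_max_face_iff[OF cv] by blast
  have img: "(\<lambda>x. s - x) ` P = P"
  proof
    show "P \<subseteq> (\<lambda>x. s - x) ` P"
    proof
      fix x assume "x \<in> P"
      then have "s - (s - x) \<in> (\<lambda>x. s - x) ` P" using s by blast
      then show "x \<in> (\<lambda>x. s - x) ` P" by simp
    qed
  qed (use s in blast)
  have op: "(\<lambda>x. s - x) = (+) s \<circ> uminus" by auto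
  have "closed_segment (s - (b + e)) (s - (b + e) + e) = closed_segment (s - b) (s - (b + e))"
    by (simp add: closed_segment_commute)
  also have "\<dots> = (\<lambda>x. s - x) ` closed_segment b (b + e)"
    unfolding op image_comp[symmetric]
    by (simp add: closed_segment_linear_image[symmetric] linear_uminus flip: closed_segment_translation)
  finally have eq: "closed_segment (s - (b + e)) (s - (b + e) + e) = (\<lambda>x. s - x) ` closed_segment b (b + e)" .
  have "uminus ` closed_segment b (b + e) face_of uminus ` P"
    using b(1) by (subst face_of_linear_image) (auto simp: linear_uminus)
  then have "(\<lambda>x. s - x) ` closed_segment b (b + e) face_of (\<lambda>x. s - x) ` P"
    unfolding op image_comp[symmetric] by simp
  moreover have "(\<lambda>x. s - x) ` closed_segment b (b + e) \<subseteq> max_face P (- u)"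
    using b(2) max_face_opposite[OF s] by blast
  ultimately show ?thesis
    using \<open>e \<noteq> 0\<close> has_edge_max_face_iff[OF cv] unfolding img eq[symmetric] by blast
qed

lemma polygon_faces_symmetric_face:
  assumes "polygon_faces_symmetric P" "F face_of P"
  shows "polygon_faces_symmetric F"
  using assms face_of_trans unfolding polygon_faces_symmetric_def by blast

text \<open>Only the component of \<open>u\<close> in the space \<open>W\<close> of directions of \<open>P\<close> orthogonal to \<open>e\<close>
  matters. The nonzero \<open>u \<in> W\<close> with the claimed property form a closed set, because there are finitely
  many faces, and an open set, because near \<open>u\<close> all maximal faces of \<open>P\<close> are maximal faces of the proper
  face belonging to \<open>u\<close>, to which the induction hypothesis applies. The punctured space is connected unless \<open>W\<close> is a line; in that case \<open>P\<close>
  is a polygon, and its central symmetry interchanges the two directions.\<close>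

lemma edge_directions_of_all_maximal_faces:
  fixes P :: "'a::euclidean_space set"
  assumes "polytope P" "polygon_faces_symmetric P" "has_edge P e" "u \<bullet> e = 0"
  shows "has_edge (max_face P u) e"
  using assms
proof (induction "nat (aff_dim P)" arbitrary: P u rule: less_induct)
  case less
  note P = less.prems(1) and sym = less.prems(2) and edge = less.prems(3) and ue = less.prems(4)
  have cv: "convex P" using P by (rule polytope_imp_convex)
  obtain b where b: "closed_segment b (b + e) face_of P" and "e \<noteq> 0"
    using edge by (auto simp: has_edge_def)
  have "closed_segment b (b + e) \<subseteq> P" using b by (rule face_of_imp_subset)
  then have "b \<in> P" "b + e \<in> P" by auto
  then have "P \<noteq> {}" by blast
  define D where "D = span ((\<lambda>x. x - b) ` P)"
  have inD: "x - y \<in> D" if "x \<in> P" "y \<in> P" for x y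
  proof -
    have "x - b \<in> D" "y - b \<in> D" using that by (auto simp: D_def intro: span_base)
    then have "(x - b) - (y - b) \<in> D" unfolding D_def by (rule span_diff)
    then show ?thesis by simp
  qed
  have eD: "e \<in> D" using inD[OF \<open>b + e \<in> P\<close> \<open>b \<in> P\<close>] by simp
  define W where "W = {w \<in> D. \<forall>x\<in>span {e}. orthogonal x w}"
  have W_iff: "w \<in> W \<longleftrightarrow> w \<in> D \<and> w \<bullet> e = 0" for w
  proof -
    have "(\<forall>x\<in>span {e}. orthogonal x w) \<longleftrightarrow> w \<bullet> e = 0"
    proof
      assume "\<forall>x\<in>span {e}. orthogonal x w"
      then have "orthogonal e w" using span_base by blast
      then show "w \<bullet> e = 0" by (simp add: orthogonal_def inner_commute)
    next
      assume "w \<bullet> e = 0"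
      then show "\<forall>x\<in>span {e}. orthogonal x w"
        by (auto simp: span_singleton orthogonal_def inner_commute)
    qed
    then show ?thesis by (simp add: W_def)
  qed
  have subW: "subspace W"
    unfolding subspace_def
    by (auto simp: W_iff D_def span_0 span_add span_scale inner_add_left)
  \<comment> \<open>the component of a normal vector orthogonal to all directions of P does not affect its maximal face\<close>
  have decomp: "\<exists>w\<in>W. max_face P v = max_face P w" if "v \<bullet> e = 0" for v
  proof -
    obtain w z where wz: "w \<in> D" "\<And>y. y \<in> D \<Longrightarrow> orthogonal z y" "v = w + z"
      using orthogonal_subspace_decomp_exists[of "(\<lambda>x. x - b) ` P" v] unfolding D_def by metis
    have "z \<bullet> x = z \<bullet> y" if "x \<in> P" "y \<in> P" for x y
      using wz(2)[OF inD[OF that]] by (simp add: orthogonal_def inner_diff_right)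
    then have "max_face P v = max_face P w" unfolding wz(3) by (rule max_face_constant)
    moreover have "w \<in> W"
      using wz(2)[OF eD] that by (simp add: W_iff wz(1) wz(3) orthogonal_def inner_add_left)
    ultimately show ?thesis by blast
  qed
  define A where "A = {w \<in> W - {0}. has_edge (max_face P w) e}"
  have "W - {0} \<subseteq> A" if ne: "A \<noteq> {}"
  proof (cases "aff_dim W = 1")
    case True
    have "span {e} \<subseteq> D"
      using eD unfolding D_def by (intro span_minimal) auto
    then have "dim W + dim (span {e}) = dim D"
      unfolding W_def
      by (intro dim_subspace_orthogonal_to_vectors) (auto simp: D_def)
    then have "dim W + 1 = dim D" using \<open>e \<noteq> 0\<close> by (simp add: dim_span)
    moreover have "dim W = 1" using True aff_dim_subspace[OF subW] by simp
    ultimately have "aff_dim P = 2"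
      using aff_dim_eq_dim_subtract[of b P] \<open>b \<in> P\<close> by (simp add: hull_inc D_def dim_span)
    then obtain s where s: "\<And>x. x \<in> P \<Longrightarrow> s - x \<in> P"
      using sym face_of_refl[OF cv] unfolding polygon_faces_symmetric_def by blast
    obtain w where w: "w \<in> W" "w \<noteq> 0" "has_edge (max_face P w) e" using ne by (auto simp: A_def)
    have "W = span {w}"
    proof -
      have "span {w} = span W"
      proof (rule dim_eq_span)
        show "dim W \<le> dim {w}" using \<open>dim W = 1\<close> w(2) by simp
      qed (use w in auto)
      then show ?thesis using subW span_eq_iff by blast
    qed
    show ?thesis
    proof
      fix v assume v: "v \<in> W - {0}"
      then obtain k where k: "v = k *\<^sub>R w" "k \<noteq> 0"
        using \<open>W = span {w}\<close> by (auto simp: span_singleton)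
      show "v \<in> A"
      proof (cases "k > 0")
        case True
        then show ?thesis using v w(3) max_face_scaleR[OF True, of P w] by (simp add: A_def k(1))
      next
        case False
        then have "max_face P v = max_face P (- w)"
          using k max_face_scaleR[of "- k" P "- w"] by simp
        then show ?thesis
          using v has_edge_max_face_opposite[OF cv s w(3)] by (simp add: A_def)
      qed
    qed
  next
    case False
    have "connected (W - {0})"
      using False subW by (intro connected_punctured_convex subspace_imp_convex)
    moreover have "openin (top_of_set (W - {0})) A"
      unfolding openin_contains_ball
    proof (intro conjI ballI)
      show "A \<subseteq> W - {0}" by (auto simp: A_def)
      fix w assume "w \<in> A"
      then have w: "w \<in> W" "w \<noteq> 0" and we: "has_edge (max_face P w) e" by (auto simp: A_def)
      define G where "G = max_face P w"
      have GP: "G face_of P" unfolding G_def by (rule max_face_face_of[OF cv])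
      have "G \<noteq> P"
      proof
        assume "G = P"
        then have "w \<bullet> y \<le> w \<bullet> x" if "x \<in> P" "y \<in> P" for x y
          using that unfolding G_def max_face_def by blast
        then have const: "w \<bullet> x = w \<bullet> b" if "x \<in> P" for x
          using that \<open>b \<in> P\<close> by (meson order_antisym)
        have "orthogonal w d" if d: "d \<in> (\<lambda>x. x - b) ` P" for d
        proof -
          obtain x where "x \<in> P" "d = x - b" using d by blast
          then show ?thesis using const[of x] by (simp add: orthogonal_def inner_diff_right)
        qed
        moreover have "w \<in> span ((\<lambda>x. x - b) ` P)" using w(1) W_iff D_def by blast
        ultimately have "orthogonal w w" by (metis orthogonal_to_span)
        then show False using w(2) by (simp add: orthogonal_self)
      qed
      have "aff_dim G < aff_dim P" by (rule face_of_aff_dim_lt[OF cv GP \<open>G \<noteq> P\<close>])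
      moreover have "G \<noteq> {}" using we by (auto simp: has_edge_def G_def)
      ultimately have dim: "nat (aff_dim G) < nat (aff_dim P)"
        using aff_dim_geq[of G] aff_dim_empty[of G] by linarith
      obtain \<epsilon> where "\<epsilon> > 0" and \<epsilon>: "\<And>w'. w' \<in> ball w \<epsilon> \<Longrightarrow> max_face P w' = max_face G w'"
        using max_face_locally_iterated[OF P \<open>P \<noteq> {}\<close>, of w] unfolding G_def by blast
      have "w' \<in> A" if w': "w' \<in> ball w \<epsilon> \<inter> (W - {0})" for w'
      proof -
        have "has_edge (max_face G w') e"
        proof (rule less.hyps[OF dim])
          show "polytope G" using P GP face_of_polytope_polytope by blast
          show "polygon_faces_symmetric G" by (rule polygon_faces_symmetric_face[OF sym GP])
          show "has_edge G e" using we by (simp add: G_def)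
          show "w' \<bullet> e = 0" using w' W_iff by blast
        qed
        then show ?thesis using \<epsilon> w' by (simp add: A_def)
      qed
      then show "\<exists>\<epsilon>>0. ball w \<epsilon> \<inter> (W - {0}) \<subseteq> A" using \<open>\<epsilon> > 0\<close> by blast
    qed
    moreover have "closedin (top_of_set (W - {0})) A"
    proof -
      define \<S> where "\<S> = {S. S face_of P \<and> (\<exists>b. S = closed_segment b (b + e))}"
      have "finite \<S>"
        using finite_polytope_faces[OF P] by (rule rev_finite_subset) (auto simp: \<S>_def)
      have "closed {w. S \<subseteq> max_face P w}" if "S \<in> \<S>" for S
      proof -
        have "S \<subseteq> P" using that face_of_imp_subset by (auto simp: \<S>_def)
        then have "{w. S \<subseteq> max_face P w} = (\<Inter>x\<in>S. \<Inter>y\<in>P. {w. w \<bullet> y \<le> w \<bullet> x})"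
          by (auto simp: max_face_def)
        also have "closed \<dots>"
          by (intro closed_INT ballI closed_Collect_le continuous_intros)
        finally show ?thesis .
      qed
      then have "closed (\<Union>S\<in>\<S>. {w. S \<subseteq> max_face P w})"
        using \<open>finite \<S>\<close> by (intro closed_UN) auto
      moreover have "A = (W - {0}) \<inter> (\<Union>S\<in>\<S>. {w. S \<subseteq> max_face P w})"
        unfolding A_def has_edge_max_face_iff[OF cv] \<S>_def using \<open>e \<noteq> 0\<close> by auto
      ultimately show ?thesis by (simp add: closedin_closed_Int)
    qed
    ultimately show ?thesis
      using ne by (metis connected_clopen order_refl)
  qed
  note spread = this
  obtain u0 where u0: "closed_segment b (b + e) = max_face P u0"
    using face_eq_max_face[OF P b] by auto
  then have "b \<in> max_face P u0" "b + e \<in> max_face P u0" by auto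
  then have "u0 \<bullet> b \<le> u0 \<bullet> (b + e)" "u0 \<bullet> (b + e) \<le> u0 \<bullet> b"
    using \<open>b \<in> P\<close> \<open>b + e \<in> P\<close> by (auto simp: max_face_def)
  then have "u0 \<bullet> e = 0" by (simp add: inner_add_right)
  then obtain w0 where w0: "w0 \<in> W" "max_face P u0 = max_face P w0" using decomp by blast
  have "has_edge (max_face P w0) e"
    unfolding w0(2)[symmetric] u0[symmetric] has_edge_def
    using \<open>e \<noteq> 0\<close> face_of_refl[OF convex_closed_segment] by blast
  then have w0A: "w0 = 0 \<or> w0 \<in> A" using w0(1) by (auto simp: A_def)
  obtain w where w: "w \<in> W" "max_face P u = max_face P w" using decomp[OF ue] by blast
  show ?case
  proof (cases "w = 0")
    case True
    then show ?thesis using w(2) edge by simp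
  next
    case False
    show ?thesis
    proof (cases "w0 = 0")
      case True
      then have "P = closed_segment b (b + e)" using u0 w0(2) by simp
      then have const: "w \<bullet> x = w \<bullet> b" if "x \<in> P" for x
        using that w(1) by (auto simp: W_iff in_segment inner_add_right left_diff_distrib)
      have "w \<bullet> y \<le> w \<bullet> x" if "x \<in> P" "y \<in> P" for x y
        using const[OF that(1)] const[OF that(2)] by simp
      then have "max_face P w = P" by (auto simp: max_face_def)
      then show ?thesis using edge w(2) by simp
    next
      case False
      then have "w \<in> A" using w0A spread w(1) \<open>w \<noteq> 0\<close> by blast
      then show ?thesis by (simp add: A_def w(2))
    qed
  qed
qed

text \<open>A direction that exposes an edge with vector \<open>k *\<^sub>R e\<close> is orthogonal to \<open>e\<close>, so this edge has in turn an
  edge with vector \<open>e\<close>; but a segment has no edge other than itself.\<close>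

lemma parallel_edges_congruent:
  fixes P :: "'a::euclidean_space set"
  assumes P: "polytope P" "polygon_faces_symmetric P"
    and e: "has_edge P e" "has_edge P (k *\<^sub>R e)"
  shows "k = 1 \<or> k = - 1"
proof -
  have "k *\<^sub>R e \<noteq> 0" using e(2) by (auto simp: has_edge_def)
  then have "k \<noteq> 0" "e \<noteq> 0" by auto
  obtain b where b: "closed_segment b (b + k *\<^sub>R e) face_of P"
    using e(2) by (auto simp: has_edge_def)
  define S where "S = closed_segment b (b + k *\<^sub>R e)"
  obtain u where u: "S = max_face P u"
    using face_eq_max_face[OF P(1) b] by (auto simp: S_def)
  have "b \<in> max_face P u" "b + k *\<^sub>R e \<in> max_face P u" unfolding u[symmetric] S_def by auto
  then have "u \<bullet> b \<le> u \<bullet> (b + k *\<^sub>R e)" "u \<bullet> (b + k *\<^sub>R e) \<le> u \<bullet> b"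
    by (auto simp: max_face_def)
  then have "u \<bullet> e = 0" using \<open>k \<noteq> 0\<close> by (simp add: inner_add_right)
  then have "has_edge S e"
    unfolding u by (rule edge_directions_of_all_maximal_faces[OF P e(1)])
  then obtain c where c: "closed_segment c (c + e) face_of S" by (auto simp: has_edge_def)
  have "aff_dim S = 1" "aff_dim (closed_segment c (c + e)) = 1"
    using \<open>e \<noteq> 0\<close> \<open>k \<noteq> 0\<close> by (simp_all add: S_def segment_convex_hull aff_dim_convex_hull aff_dim_2)
  then have "closed_segment c (c + e) = S"
    using face_of_aff_dim_lt[OF _ c] by (metis S_def convex_closed_segment less_irrefl)
  then have "{c, c + e} = {b, b + k *\<^sub>R e}" unfolding S_def by simp
  then have "k *\<^sub>R e = e \<or> k *\<^sub>R e + e = 0"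
    by (auto simp: doubleton_eq_iff)
  then have "(k - 1) *\<^sub>R e = 0 \<or> (k + 1) *\<^sub>R e = 0"
    by (auto simp: algebra_simps)
  then show ?thesis using \<open>e \<noteq> 0\<close> by auto
qed

section \<open>Support functions\<close>

definition support :: "'a::euclidean_space set \<Rightarrow> 'a \<Rightarrow> real" where
  "support P u = Sup ((\<bullet>) u ` P)"

lemma support_eqI:
  assumes "x \<in> P" "\<And>y. y \<in> P \<Longrightarrow> u \<bullet> y \<le> u \<bullet> x"
  shows "support P u = u \<bullet> x"
  unfolding support_def by (rule cSup_eq_maximum) (use assms in auto)

lemma support_max_face: "x \<in> max_face P u \<Longrightarrow> support P u = u \<bullet> x"
  by (rule support_eqI) (auto simp: max_face_def)

lemma support_attained:
  assumes "compact P" "P \<noteq> {}"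
  obtains x where "x \<in> P" "support P u = u \<bullet> x"
  using max_face_nonempty[OF assms, of u] support_max_face max_face_subset by blast

lemma support_upper:
  assumes "compact P" "x \<in> P"
  shows "u \<bullet> x \<le> support P u"
proof -
  obtain y where "y \<in> max_face P u" using max_face_nonempty[of P u] assms by blast
  then show ?thesis using assms(2) support_max_face[of y P u] by (simp add: max_face_def)
qed

lemma support_scaleR:
  assumes "compact P" "P \<noteq> {}" "0 \<le> t"
  shows "support P (t *\<^sub>R u) = t * support P u"
proof -
  obtain x where x: "x \<in> P" "support P u = u \<bullet> x" using support_attained assms(1,2) by blast
  have "support P (t *\<^sub>R u) = (t *\<^sub>R u) \<bullet> x"
    using x support_upper[OF assms(1), of _ u] assms(3)
    by (intro support_eqI) (auto intro: mult_left_mono)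
  then show ?thesis by (simp add: x(2))
qed

lemma support_le_add:
  assumes "compact P" "P \<noteq> {}" "\<And>x. x \<in> P \<Longrightarrow> norm x \<le> B"
  shows "\<bar>support P (u + v) - support P v\<bar> \<le> B * norm u"
proof -
  have le: "support P (a + b) - support P b \<le> B * norm a" for a b
  proof -
    obtain x where x: "x \<in> P" "support P (a + b) = (a + b) \<bullet> x"
      using support_attained assms(1,2) by blast
    have "a \<bullet> x \<le> norm a * norm x" by (rule norm_cauchy_schwarz)
    also have "\<dots> \<le> norm a * B" using assms(3)[OF x(1)] by (intro mult_left_mono) auto
    finally show ?thesis
      using x support_upper[OF assms(1) x(1), of b] by (simp add: inner_add_left mult.commute)
  qed
  show ?thesis using le[of u v] le[of "- u" "u + v"] by simp
qed

lemma closed_convex_eq_if_support_eq: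
  fixes A B :: "'a::euclidean_space set"
  assumes A: "compact A" "convex A" "A \<noteq> {}" and B: "compact B" "convex B" "B \<noteq> {}"
    and eq: "\<And>u. support A u = support B u"
  shows "A = B"
proof -
  have sub: "C \<subseteq> D" if C: "compact C" and D: "compact D" "convex D" "D \<noteq> {}"
    and cd: "\<And>u. support C u = support D u" for C D :: "'a set"
  proof
    fix z assume "z \<in> C"
    show "z \<in> D"
    proof (rule ccontr)
      assume "z \<notin> D"
      then obtain a b where ab: "a \<bullet> z < b" "\<And>x. x \<in> D \<Longrightarrow> b < a \<bullet> x"
        using separating_hyperplane_closed_point[OF D(2) compact_imp_closed[OF D(1)]] by blast
      obtain x where x: "x \<in> D" "support D (- a) = (- a) \<bullet> x"
        using support_attained D(1,3) by blast
      have "(- a) \<bullet> z \<le> support D (- a)"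
        using support_upper[OF C \<open>z \<in> C\<close>, of "- a"] cd by simp
      then show False using ab(1) ab(2)[OF x(1)] x(2) by simp
    qed
  qed
  show ?thesis using sub[OF A(1) B] sub[OF B(1) A] eq by auto
qed

lemma support_locally_max_face:
  fixes P :: "'a::euclidean_space set"
  assumes P: "polytope P" "P \<noteq> {}"
  shows "eventually (\<lambda>u'. support P u' = support (max_face P u) u') (nhds u)"
proof -
  obtain \<epsilon> where \<epsilon>: "\<epsilon> > 0" "\<And>u'. u' \<in> ball u \<epsilon> \<Longrightarrow> max_face P u' = max_face (max_face P u) u'"
    using max_face_locally_iterated[OF P, of u] by blast
  have "support P u' = support (max_face P u) u'" if "u' \<in> ball u \<epsilon>" for u'
  proof -
    obtain x where "x \<in> max_face P u'"
      using max_face_nonempty[OF polytope_imp_compact[OF P(1)] P(2), of u'] by blast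
    then show ?thesis
      using support_max_face[of x P u'] support_max_face[of x "max_face P u" u'] \<epsilon>(2)[OF that] by simp
  qed
  then show ?thesis
    using \<epsilon>(1) by (auto simp: eventually_nhds_metric dist_commute intro!: exI[of _ \<epsilon>])
qed

lemma polytope_without_edges:
  fixes P :: "'a::euclidean_space set"
  assumes "polytope P" "x \<in> P" "\<And>e. \<not> has_edge P e"
  shows "P = {x}"
proof -
  have "y = x" if "y \<in> P" for y
  proof (rule ccontr)
    assume "y \<noteq> x"
    then have "(y - x) \<bullet> (y - x) \<noteq> 0" by simp
    then have "(y - x) \<bullet> x \<noteq> (y - x) \<bullet> y" by (simp add: inner_diff_right)
    then show False using nonconstant_on_edge[OF assms(1) assms(2) that] assms(3) by blast
  qed
  then show ?thesis using assms(2) by blast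
qed

text \<open>A functional orthogonal to \<open>e\<close> is constant on all edges, hence on \<open>P\<close>; so \<open>P\<close> lies on a line.\<close>

lemma polytope_with_parallel_edges:
  fixes P :: "'a::euclidean_space set"
  assumes P: "polytope P" and e: "has_edge P e"
    and all: "\<And>f. has_edge P f \<Longrightarrow> \<exists>k. f = k *\<^sub>R e"
  shows "\<exists>b. P = closed_segment b (b + e)"
proof -
  obtain b where "e \<noteq> 0" and b: "closed_segment b (b + e) face_of P"
    using e by (auto simp: has_edge_def)
  have bP: "b \<in> P" using face_of_imp_subset[OF b] by auto
  have on_line: "\<exists>k. x = b + k *\<^sub>R e" if x: "x \<in> P" for x
  proof -
    define k where "k = ((x - b) \<bullet> e) / (e \<bullet> e)"
    define c where "c = (x - b) - k *\<^sub>R e"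
    have ce: "c \<bullet> e = 0" using \<open>e \<noteq> 0\<close> by (simp add: c_def k_def inner_diff_left)
    have "c \<bullet> x = c \<bullet> b"
    proof (rule ccontr)
      assume "c \<bullet> x \<noteq> c \<bullet> b"
      then obtain f where f: "has_edge P f" "c \<bullet> f \<noteq> 0"
        using nonconstant_on_edge[OF P x bP] by blast
      obtain j where "f = j *\<^sub>R e" using all[OF f(1)] by blast
      then show False using f(2) ce by simp
    qed
    then have "c \<bullet> (x - b) = 0" by (simp add: inner_diff_right)
    moreover have "c \<bullet> c = c \<bullet> (x - b) - k * (c \<bullet> e)"
      unfolding c_def by (simp add: inner_diff_right)
    ultimately have "c = 0" using ce by simp
    then show ?thesis by (intro exI[of _ k]) (simp add: c_def algebra_simps)
  qed
  have "P \<subseteq> affine hull {b, b + e}"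
  proof
    fix x assume "x \<in> P"
    then obtain k where "x = b + k *\<^sub>R e" using on_line by blast
    then have "x = (1 - k) *\<^sub>R b + k *\<^sub>R (b + e)" by (simp add: algebra_simps)
    then show "x \<in> affine hull {b, b + e}"
      unfolding affine_hull_2 by (intro CollectI exI[of _ "1 - k"] exI[of _ k]) simp
  qed
  then have "aff_dim P \<le> aff_dim (affine hull {b, b + e})" by (rule aff_dim_subset)
  also have "\<dots> \<le> 1" by (simp add: aff_dim_affine_hull aff_dim_2)
  finally have "aff_dim P \<le> aff_dim (closed_segment b (b + e))"
    using \<open>e \<noteq> 0\<close> by (simp add: segment_convex_hull aff_dim_convex_hull aff_dim_2)
  then have "closed_segment b (b + e) = P"
    using face_of_aff_dim_lt[OF polytope_imp_convex[OF P] b] by fastforce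
  then show ?thesis by blast
qed

lemma finite_edge_vectors:
  fixes P :: "'a::euclidean_space set"
  assumes "polytope P"
  shows "finite {e. has_edge P e}"
proof -
  define V where "V = {v. v extreme_point_of P}"
  have "finite V"
    unfolding V_def by (rule finite_polyhedron_extreme_points[OF polytope_imp_polyhedron[OF assms]])
  moreover have "{e. has_edge P e} \<subseteq> (\<lambda>(x, y). y - x) ` (V \<times> V)"
  proof clarify
    fix e assume "has_edge P e"
    then obtain b where "closed_segment b (b + e) face_of P" by (auto simp: has_edge_def)
    then have "(b, b + e) \<in> V \<times> V" using segment_face_of by (auto simp: V_def)
    then show "e \<in> (\<lambda>(x, y). y - x) ` (V \<times> V)"
      by (intro image_eqI[of _ _ "(b, b + e)"]) auto
  qed
  ultimately show ?thesis by (meson finite_SigmaI finite_imageI finite_subset)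
qed

lemma has_edge_uminus:
  assumes "has_edge P e"
  shows "has_edge P (- e)"
proof -
  obtain b where "e \<noteq> 0" "closed_segment b (b + e) face_of P"
    using assms by (auto simp: has_edge_def)
  then have "closed_segment (b + e) (b + e + - e) face_of P"
    by (simp add: closed_segment_commute)
  then show ?thesis using \<open>e \<noteq> 0\<close> unfolding has_edge_def by (metis neg_equal_0_iff_equal)
qed

text \<open>Finitely many hyperplanes do not cover the space.\<close>

lemma exists_nonorthogonal_vector:
  fixes S :: "'a::euclidean_space set"
  assumes "finite S" "0 \<notin> S"
  shows "\<exists>c. \<forall>e\<in>S. c \<bullet> e \<noteq> 0"
proof -
  have "negligible (\<Union>e\<in>S. {x. e \<bullet> x = 0})"
    using assms by (intro negligible_Union) (auto intro!: negligible_hyperplane)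
  then have "(\<Union>e\<in>S. {x. e \<bullet> x = 0}) \<noteq> UNIV" using non_negligible_UNIV by metis
  then show ?thesis by (auto simp: inner_commute)
qed

text \<open>The derivative is locally constant, hence constant.\<close>

lemma locally_affine_imp_affine:
  fixes g :: "real \<Rightarrow> real"
  assumes loc: "\<And>t0. \<exists>\<alpha> \<beta>. eventually (\<lambda>t. g t = \<alpha> + \<beta> * t) (nhds t0)"
  shows "\<exists>\<alpha> \<beta>. \<forall>t. g t = \<alpha> + \<beta> * t"
proof -
  have der: "DERIV g t :> \<beta>" if "eventually (\<lambda>t. g t = \<alpha> + \<beta> * t) (nhds t)" for t \<alpha> \<beta>
    by (subst DERIV_cong_ev[OF refl that refl]) (auto intro!: derivative_eq_intros)
  have "DERIV (deriv g) t0 :> 0" for t0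
  proof -
    obtain \<alpha> \<beta> where ab: "eventually (\<lambda>t. g t = \<alpha> + \<beta> * t) (nhds t0)" using loc by blast
    then have "eventually (\<lambda>t. eventually (\<lambda>t. g t = \<alpha> + \<beta> * t) (nhds t)) (nhds t0)"
      by (simp add: eventually_eventually)
    then have "eventually (\<lambda>t. deriv g t = \<beta>) (nhds t0)"
      by eventually_elim (rule DERIV_imp_deriv[OF der])
    then show ?thesis by (subst DERIV_cong_ev[OF refl _ refl]) (auto intro!: derivative_eq_intros)
  qed
  then have const: "deriv g t = deriv g 0" for t using DERIV_isconst_all by blast
  have "DERIV g t :> deriv g 0" for t
    using der loc const DERIV_imp_deriv by metis
  then have "DERIV (\<lambda>t. g t - deriv g 0 * t) t :> 0" for t
    by (auto intro!: derivative_eq_intros)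
  then have eq: "g t - deriv g 0 * t = g 0 - deriv g 0 * 0" for t
    using DERIV_isconst_all[of "\<lambda>t. g t - deriv g 0 * t"] by blast
  have "g t = g 0 + deriv g 0 * t" for t using eq[of t] by simp
  then show ?thesis by blast
qed

section \<open>The sum of the edge segments\<close>

text \<open>One vector out of each pair \<open>e\<close>, \<open>-e\<close> of edge vectors, chosen on the positive side of a hyperplane, so
  that no two chosen vectors are antiparallel.\<close>

definition edge_transversal :: "'a::euclidean_space set \<Rightarrow> 'a set \<Rightarrow> bool" where
  "edge_transversal P D \<longleftrightarrow>
     (\<forall>e. has_edge P e \<longleftrightarrow> e \<in> D \<or> - e \<in> D) \<and> (\<exists>c. \<forall>e\<in>D. 0 < c \<bullet> e)"

lemma edge_transversal_exists:
  fixes P :: "'a::euclidean_space set"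
  assumes "polytope P"
  obtains D where "edge_transversal P D"
proof -
  have "0 \<notin> {e. has_edge P e}" by (simp add: has_edge_def)
  then obtain c where c: "\<And>e. has_edge P e \<Longrightarrow> c \<bullet> e \<noteq> 0"
    using exists_nonorthogonal_vector[OF finite_edge_vectors[OF assms]] by auto
  have "edge_transversal P {e. has_edge P e \<and> 0 < c \<bullet> e}"
    unfolding edge_transversal_def
  proof (intro conjI allI exI[of _ c])
    fix e
    show "has_edge P e \<longleftrightarrow> e \<in> {e. has_edge P e \<and> 0 < c \<bullet> e} \<or> - e \<in> {e. has_edge P e \<and> 0 < c \<bullet> e}"
      using c[of e] has_edge_uminus[of P e] has_edge_uminus[of P "- e"] by auto
  qed auto
  then show ?thesis by (rule that)
qed

lemma edge_transversal_finite:
  assumes "polytope P" "edge_transversal P D"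
  shows "finite D"
  by (rule finite_subset[OF _ finite_edge_vectors[OF assms(1)]])
    (use assms(2) in \<open>auto simp: edge_transversal_def\<close>)

lemma edge_transversal_edge:
  assumes "edge_transversal P D" "e \<in> D"
  shows "has_edge P e" "e \<noteq> 0"
  using assms by (auto simp: edge_transversal_def has_edge_def)

lemma edge_transversal_nonparallel:
  assumes P: "polytope P" "polygon_faces_symmetric P" and D: "edge_transversal P D"
    and e: "e \<in> D" "k *\<^sub>R e \<in> D"
  shows "k = 1"
proof -
  have "k = 1 \<or> k = - 1"
    using parallel_edges_congruent[OF P] edge_transversal_edge[OF D] e by blast
  moreover obtain c where "\<And>e. e \<in> D \<Longrightarrow> 0 < c \<bullet> e" using D by (auto simp: edge_transversal_def)
  then have "0 < c \<bullet> e" "0 < c \<bullet> (k *\<^sub>R e)" using e by blast+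
  ultimately show ?thesis by auto
qed

lemma support_segment:
  "support (closed_segment b (b + e)) u = u \<bullet> (b + (1/2) *\<^sub>R e) + \<bar>e \<bullet> u\<bar> / 2"
proof -
  have upper: "u \<bullet> (b + t *\<^sub>R e) \<le> u \<bullet> b + (if 0 \<le> u \<bullet> e then u \<bullet> e else 0)"
    if "0 \<le> t" "t \<le> 1" for t
    using that mult_right_mono[of t 1 "u \<bullet> e"] by (auto simp: inner_add_right mult_nonneg_nonpos)
  have seg: "\<exists>t. 0 \<le> t \<and> t \<le> 1 \<and> y = b + t *\<^sub>R e" if "y \<in> closed_segment b (b + e)" for y
  proof -
    obtain t where "0 \<le> t" "t \<le> 1" "y = (1 - t) *\<^sub>R b + t *\<^sub>R (b + e)"
      using \<open>y \<in> closed_segment b (b + e)\<close> unfolding in_segment by blast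
    then show ?thesis by (intro exI[of _ t]) (simp add: algebra_simps)
  qed
  have "support (closed_segment b (b + e)) u = u \<bullet> (if 0 \<le> u \<bullet> e then b + e else b)"
  proof (rule support_eqI)
    fix y assume "y \<in> closed_segment b (b + e)"
    then obtain t where "0 \<le> t" "t \<le> 1" "y = b + t *\<^sub>R e" using seg by blast
    then show "u \<bullet> y \<le> u \<bullet> (if 0 \<le> u \<bullet> e then b + e else b)"
      using upper[of t] by (auto simp: inner_add_right split: if_splits)
  qed auto
  then show ?thesis by (auto simp: inner_add_right inner_commute)
qed

text \<open>Near \<open>u\<close> the support function of \<open>P\<close> is that of the maximal face \<open>G\<close> for \<open>u\<close>, all of whose edges are
  orthogonal to \<open>u\<close>. If no chosen edge vector is orthogonal to \<open>u\<close>, then \<open>G\<close> is a vertex and neither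
  term has a kink. If \<open>e\<close> is the only one, then \<open>G\<close> is an edge with vector \<open>e\<close> and both terms have the
  kink \<open>\<bar>e \<bullet> v\<bar> / 2\<close>.\<close>

lemma support_minus_edges_locally_linear:
  fixes P :: "'a::euclidean_space set"
  assumes P: "polytope P" "polygon_faces_symmetric P" "P \<noteq> {}" and D: "edge_transversal P D"
    and one: "\<And>e e'. e \<in> D \<Longrightarrow> e' \<in> D \<Longrightarrow> e \<bullet> u = 0 \<Longrightarrow> e' \<bullet> u = 0 \<Longrightarrow> e = e'"
  shows "\<exists>y. eventually (\<lambda>v. support P v - (\<Sum>e\<in>D. \<bar>e \<bullet> v\<bar> / 2) = y \<bullet> v) (nhds u)"
proof -
  define G where "G = max_face P u"
  define Z where "Z = {e \<in> D. e \<bullet> u = 0}"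
  have fin: "finite D" by (rule edge_transversal_finite[OF P(1) D])
  have GP: "G face_of P" unfolding G_def by (rule max_face_face_of[OF polytope_imp_convex[OF P(1)]])
  have polG: "polytope G" using P(1) GP face_of_polytope_polytope by blast
  have "G \<noteq> {}" unfolding G_def by (rule max_face_nonempty[OF polytope_imp_compact[OF P(1)] P(3)])
  have edgeG: "e \<in> Z \<or> - e \<in> Z" if eG: "has_edge G e" for e
  proof -
    have "has_edge P e" by (rule has_edge_face[OF GP eG])
    then have "e \<in> D \<or> - e \<in> D" using D by (auto simp: edge_transversal_def)
    moreover have "e \<bullet> u = 0"
    proof -
      obtain b where "closed_segment b (b + e) face_of G" using eG by (auto simp: has_edge_def)
      then have "closed_segment b (b + e) \<subseteq> G" by (rule face_of_imp_subset)
      then have "b \<in> G" "b + e \<in> G" by auto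
      then have "u \<bullet> b \<le> u \<bullet> (b + e)" "u \<bullet> (b + e) \<le> u \<bullet> b" by (auto simp: G_def max_face_def)
      then show ?thesis by (simp add: inner_add_right inner_commute)
    qed
    ultimately show ?thesis by (auto simp: Z_def)
  qed
  have kink: "\<exists>z. \<forall>v. support G v = z \<bullet> v + (\<Sum>e\<in>Z. \<bar>e \<bullet> v\<bar> / 2)"
  proof (cases "Z = {}")
    case True
    obtain x where x: "x \<in> G" using \<open>G \<noteq> {}\<close> by blast
    have "G = {x}" by (rule polytope_without_edges[OF polG x]) (use edgeG True in blast)
    then have "support G v = x \<bullet> v" for v
      using support_eqI[of x G v] by (simp add: inner_commute)
    then show ?thesis using True by auto
  next
    case False
    then obtain e where e: "e \<in> Z" by blast
    then have Z: "Z = {e}" using one by (auto simp: Z_def)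
    have "u \<bullet> e = 0" "e \<in> D" using e by (auto simp: Z_def inner_commute)
    then have "has_edge G e"
      unfolding G_def
      by (intro edge_directions_of_all_maximal_faces P edge_transversal_edge[OF D])
    moreover have "\<exists>k. f = k *\<^sub>R e" if "has_edge G f" for f
    proof -
      have "f = 1 *\<^sub>R e \<or> f = (- 1) *\<^sub>R e" using edgeG[OF that] Z by auto
      then show ?thesis by blast
    qed
    ultimately obtain b where "G = closed_segment b (b + e)"
      using polytope_with_parallel_edges[OF polG] by blast
    then have "support G v = (b + (1/2) *\<^sub>R e) \<bullet> v + (\<Sum>e\<in>Z. \<bar>e \<bullet> v\<bar> / 2)" for v
      by (simp add: support_segment Z inner_commute)
    then show ?thesis by blast
  qed
  then obtain z where z: "\<And>v. support G v = z \<bullet> v + (\<Sum>e\<in>Z. \<bar>e \<bullet> v\<bar> / 2)" by blast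
  define y where "y = z - (\<Sum>e\<in>D - Z. (sgn (e \<bullet> u) / 2) *\<^sub>R e)"
  have "eventually (\<lambda>v. \<bar>e \<bullet> v\<bar> = sgn (e \<bullet> u) * (e \<bullet> v)) (nhds u)" if "e \<in> D - Z" for e
  proof -
    have tends: "((\<lambda>v. e \<bullet> v) \<longlongrightarrow> e \<bullet> u) (nhds u)" by (intro tendsto_intros filterlim_ident)
    have "e \<bullet> u \<noteq> 0" using that by (auto simp: Z_def)
    then consider "0 < e \<bullet> u" | "e \<bullet> u < 0" by linarith
    then show ?thesis
    proof cases
      case 1
      show ?thesis using order_tendstoD(1)[OF tends 1] by eventually_elim (use 1 in simp)
    next
      case 2
      show ?thesis using order_tendstoD(2)[OF tends 2] by eventually_elim (use 2 in simp)
    qed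
  qed
  then have "eventually (\<lambda>v. \<forall>e\<in>D - Z. \<bar>e \<bullet> v\<bar> = sgn (e \<bullet> u) * (e \<bullet> v)) (nhds u)"
    using fin by (intro eventually_ball_finite) auto
  moreover have "eventually (\<lambda>v. support P v = support G v) (nhds u)"
    unfolding G_def by (rule support_locally_max_face[OF P(1,3)])
  ultimately have "eventually (\<lambda>v. support P v - (\<Sum>e\<in>D. \<bar>e \<bullet> v\<bar> / 2) = y \<bullet> v) (nhds u)"
  proof eventually_elim
    case (elim v)
    have "(\<Sum>e\<in>D. \<bar>e \<bullet> v\<bar> / 2) = (\<Sum>e\<in>D - Z. \<bar>e \<bullet> v\<bar> / 2) + (\<Sum>e\<in>Z. \<bar>e \<bullet> v\<bar> / 2)"
      using fin by (intro sum.subset_diff) (auto simp: Z_def)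
    also have "(\<Sum>e\<in>D - Z. \<bar>e \<bullet> v\<bar> / 2) = (\<Sum>e\<in>D - Z. (sgn (e \<bullet> u) / 2) *\<^sub>R e) \<bullet> v"
      using elim(1) unfolding inner_sum_left by (intro sum.cong) auto
    finally show ?case
      using elim(2) z[of v] by (simp add: y_def inner_diff_left)
  qed
  then show ?thesis by blast
qed

text \<open>Let \<open>F\<close> be the difference of the two sides. On a line in direction \<open>d\<close> through a generic point \<open>u0\<close>
  no two distinct vectors of \<open>D\<close> become orthogonal to the moving point at the same time, so
  \<open>F\<close> is locally affine, hence affine, along it. As \<open>F\<close> is positively
  homogeneous, even and Lipschitz, it differs there from \<open>\<bar>t\<bar> F(d)\<close> by a bounded amount, and an affine
  function can do so only for \<open>F(d) = 0\<close>.\<close>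

theorem support_eq_sum_edges:
  fixes P :: "'a::euclidean_space set"
  assumes P: "polytope P" "polygon_faces_symmetric P" "P \<noteq> {}" and D: "edge_transversal P D"
    and sym: "\<And>x. x \<in> P \<Longrightarrow> - x \<in> P"
  shows "support P d = (\<Sum>e\<in>D. \<bar>e \<bullet> d\<bar> / 2)"
proof -
  have fin: "finite D" by (rule edge_transversal_finite[OF P(1) D])
  have co: "compact P" by (rule polytope_imp_compact[OF P(1)])
  define F where "F v = support P v - (\<Sum>e\<in>D. \<bar>e \<bullet> v\<bar> / 2)" for v
  \<comment> \<open>if e and e' are both orthogonal to a point of the line, then u0 is orthogonal to cr (e, e')\<close>
  define cr where "cr = (\<lambda>(e, e'). (e \<bullet> d) *\<^sub>R e' - (e' \<bullet> d) *\<^sub>R e)"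
  define S where "S = D \<union> (cr ` (D \<times> D) - {0})"
  have "finite S" using fin by (simp add: S_def)
  moreover have "0 \<notin> S" using edge_transversal_edge[OF D] by (auto simp: S_def)
  ultimately have "\<exists>c. \<forall>e\<in>S. c \<bullet> e \<noteq> 0" by (rule exists_nonorthogonal_vector)
  then obtain u0 where u0: "\<And>e. e \<in> S \<Longrightarrow> u0 \<bullet> e \<noteq> 0" by blast
  have one: "e = e'"
    if e: "e \<in> D" "e' \<in> D" "e \<bullet> (u0 + t *\<^sub>R d) = 0" "e' \<bullet> (u0 + t *\<^sub>R d) = 0" for e e' t
  proof (rule ccontr)
    assume "e \<noteq> e'"
    have eq: "u0 \<bullet> e = - t * (e \<bullet> d)" "u0 \<bullet> e' = - t * (e' \<bullet> d)"
      using e(3,4) by (auto simp: inner_add_right inner_commute)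
    have "u0 \<bullet> e \<noteq> 0" using u0 e(1) by (simp add: S_def)
    then have "e \<bullet> d \<noteq> 0" using eq(1) by auto
    have "u0 \<bullet> cr (e, e') = 0"
      by (simp add: cr_def inner_diff_right eq)
    moreover have "cr (e, e') \<noteq> 0"
    proof
      assume "cr (e, e') = 0"
      define k where "k = (e' \<bullet> d) / (e \<bullet> d)"
      have "(e \<bullet> d) *\<^sub>R e' = (e' \<bullet> d) *\<^sub>R e" using \<open>cr (e, e') = 0\<close> by (simp add: cr_def)
      then have "(1 / (e \<bullet> d)) *\<^sub>R ((e \<bullet> d) *\<^sub>R e') = (1 / (e \<bullet> d)) *\<^sub>R ((e' \<bullet> d) *\<^sub>R e)" by simp
      then have "e' = k *\<^sub>R e" using \<open>e \<bullet> d \<noteq> 0\<close> by (simp add: k_def)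
      then have "k = 1" using edge_transversal_nonparallel[OF P(1,2) D e(1), of k] e(2) by simp
      then show False using \<open>e' = k *\<^sub>R e\<close> \<open>e \<noteq> e'\<close> by simp
    qed
    ultimately show False using u0[of "cr (e, e')"] e(1,2) by (auto simp: S_def)
  qed
  have "\<exists>\<alpha> \<beta>. eventually (\<lambda>t. F (u0 + t *\<^sub>R d) = \<alpha> + \<beta> * t) (nhds t0)" for t0
  proof -
    have "\<exists>y. eventually (\<lambda>v. F v = y \<bullet> v) (nhds (u0 + t0 *\<^sub>R d))"
      unfolding F_def by (rule support_minus_edges_locally_linear[OF P D]) (rule one)
    then obtain y where y: "eventually (\<lambda>v. F v = y \<bullet> v) (nhds (u0 + t0 *\<^sub>R d))" by blast
    have "((\<lambda>t. u0 + t *\<^sub>R d) \<longlongrightarrow> u0 + t0 *\<^sub>R d) (nhds t0)" by (intro tendsto_intros filterlim_ident)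
    then have "eventually (\<lambda>t. F (u0 + t *\<^sub>R d) = y \<bullet> (u0 + t *\<^sub>R d)) (nhds t0)"
      by (rule eventually_compose_filterlim[OF y])
    then have "eventually (\<lambda>t. F (u0 + t *\<^sub>R d) = y \<bullet> u0 + (y \<bullet> d) * t) (nhds t0)"
      by eventually_elim (simp add: inner_add_right mult.commute)
    then show ?thesis by blast
  qed
  then obtain \<alpha> \<beta> where affine: "\<And>t. F (u0 + t *\<^sub>R d) = \<alpha> + \<beta> * t"
    using locally_affine_imp_affine[of "\<lambda>t. F (u0 + t *\<^sub>R d)"] by blast
  obtain B where B: "\<And>x. x \<in> P \<Longrightarrow> norm x \<le> B"
    using compact_imp_bounded[OF co] by (auto simp: bounded_iff)
  define C where "C = B * norm u0 + (\<Sum>e\<in>D. \<bar>e \<bullet> u0\<bar> / 2)"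
  have near: "\<bar>F (u0 + v) - F v\<bar> \<le> C" for v
  proof -
    have "\<bar>support P (u0 + v) - support P v\<bar> \<le> B * norm u0"
      by (rule support_le_add[OF co P(3) B])
    moreover have "\<bar>(\<Sum>e\<in>D. \<bar>e \<bullet> (u0 + v)\<bar> / 2) - (\<Sum>e\<in>D. \<bar>e \<bullet> v\<bar> / 2)\<bar> \<le> (\<Sum>e\<in>D. \<bar>e \<bullet> u0\<bar> / 2)"
      unfolding sum_subtractf[symmetric]
      by (rule order_trans[OF sum_abs]) (intro sum_mono, auto simp: inner_add_right abs_if)
    ultimately show ?thesis unfolding F_def C_def by linarith
  qed
  have Fpos: "F (t *\<^sub>R v) = t * F v" if "0 \<le> t" for t v
    using that support_scaleR[OF co P(3) that, of v]
    by (simp add: F_def right_diff_distrib sum_distrib_left abs_mult)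
  have "support P (- v) = support P v" for v
  proof -
    obtain x where x: "x \<in> P" "support P v = v \<bullet> x" using support_attained[OF co P(3)] by blast
    have "support P (- v) = (- v) \<bullet> (- x)"
    proof (rule support_eqI)
      show "- v \<bullet> y \<le> - v \<bullet> - x" if "y \<in> P" for y
        using support_upper[OF co sym[OF that], of v] x(2) by simp
    qed (rule sym[OF x(1)])
    then show ?thesis using x(2) by simp
  qed
  then have Feven: "F (- v) = F v" for v by (simp add: F_def)
  \<comment> \<open>adding the estimates at t and - t cancels the slope\<close>
  have bound: "t * \<bar>F d\<bar> \<le> C + \<bar>\<alpha>\<bar>" if "0 \<le> t" for t
  proof -
    have "\<bar>\<alpha> + \<beta> * t - t * F d\<bar> \<le> C"
      using near[of "t *\<^sub>R d"] affine[of t] Fpos[OF that, of d] by simp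
    moreover have "\<bar>\<alpha> - \<beta> * t - t * F d\<bar> \<le> C"
      using near[of "- (t *\<^sub>R d)"] affine[of "- t"] Fpos[OF that, of d] Feven by simp
    moreover have "\<bar>t * F d\<bar> = t * \<bar>F d\<bar>" using that by (simp add: abs_mult)
    ultimately show ?thesis by linarith
  qed
  have "F d = 0"
  proof (rule ccontr)
    assume "F d \<noteq> 0"
    then have pos: "0 < \<bar>F d\<bar>" by simp
    have "0 \<le> C + \<bar>\<alpha>\<bar>" using bound[of 0] by simp
    then have "(C + \<bar>\<alpha>\<bar> + 1) / \<bar>F d\<bar> * \<bar>F d\<bar> \<le> C + \<bar>\<alpha>\<bar>"
      using pos by (intro bound) simp
    then show False using pos by simp
  qed
  then show ?thesis by (simp add: F_def)
qed

definition segment_sum :: "'a::euclidean_space set \<Rightarrow> 'a set" where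
  "segment_sum D = {\<Sum>e\<in>D. x e *\<^sub>R e | x. \<forall>e\<in>D. \<bar>x e\<bar> \<le> 1/2}"

lemma centred_segment:
  "closed_segment (- (1/2) *\<^sub>R e) ((1/2) *\<^sub>R e) = {t *\<^sub>R e | t. \<bar>t\<bar> \<le> 1/2}"
proof (intro set_eqI iffI)
  fix y assume "y \<in> closed_segment (- (1/2) *\<^sub>R e) ((1/2) *\<^sub>R e)"
  then obtain s where s: "0 \<le> s" "s \<le> 1" "y = (1 - s) *\<^sub>R (- (1/2) *\<^sub>R e) + s *\<^sub>R ((1/2) *\<^sub>R e)"
    unfolding in_segment by blast
  have "(1 - s) * - (1/2) + s * (1/2) = s - 1/2" by (simp add: field_simps)
  then have "y = (s - 1/2) *\<^sub>R e"
    unfolding s(3) scaleR_scaleR scaleR_add_left[symmetric] by simp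
  moreover have "\<bar>s - 1/2\<bar> \<le> 1/2" using s(1,2) by linarith
  ultimately show "y \<in> {t *\<^sub>R e | t. \<bar>t\<bar> \<le> 1/2}" by blast
next
  fix y assume "y \<in> {t *\<^sub>R e | t. \<bar>t\<bar> \<le> 1/2}"
  then obtain t where t: "\<bar>t\<bar> \<le> 1/2" "y = t *\<^sub>R e" by blast
  have "(1 - (t + 1/2)) * - (1/2) + (t + 1/2) * (1/2) = t" by (simp add: field_simps)
  then have "y = (1 - (t + 1/2)) *\<^sub>R (- (1/2) *\<^sub>R e) + (t + 1/2) *\<^sub>R ((1/2) *\<^sub>R e)"
    unfolding t(2) scaleR_scaleR scaleR_add_left[symmetric] by simp
  moreover have "0 \<le> t + 1/2" "t + 1/2 \<le> 1" using t(1) by linarith+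
  ultimately show "y \<in> closed_segment (- (1/2) *\<^sub>R e) ((1/2) *\<^sub>R e)"
    unfolding in_segment by blast
qed

lemma segment_sum_eq_sum_segments:
  assumes "finite D"
  shows "segment_sum D = (\<Sum>e\<in>D. closed_segment (- (1/2) *\<^sub>R e) ((1/2) *\<^sub>R e))"
  unfolding set_sum_alt[OF assms] centred_segment
proof (intro set_eqI iffI)
  fix y assume "y \<in> segment_sum D"
  then obtain x where "y = (\<Sum>e\<in>D. x e *\<^sub>R e)" "\<forall>e\<in>D. \<bar>x e\<bar> \<le> 1/2" by (auto simp: segment_sum_def)
  then show "y \<in> {sum s D |s. \<forall>e\<in>D. s e \<in> {t *\<^sub>R e |t. \<bar>t\<bar> \<le> 1/2}}" by blast
next
  fix y assume "y \<in> {sum s D |s. \<forall>e\<in>D. s e \<in> {t *\<^sub>R e |t. \<bar>t\<bar> \<le> 1/2}}"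
  then obtain s where s: "y = sum s D" "\<forall>e\<in>D. \<exists>t. s e = t *\<^sub>R e \<and> \<bar>t\<bar> \<le> 1/2" by blast
  then obtain x where "\<forall>e\<in>D. s e = x e *\<^sub>R e \<and> \<bar>x e\<bar> \<le> 1/2" by metis
  then show "y \<in> segment_sum D" unfolding segment_sum_def s(1) by (intro CollectI exI[of _ x]) auto
qed

lemma zonotope_segment_sum:
  assumes "finite D"
  shows "zonotope (segment_sum D)"
proof -
  obtain h where h: "bij_betw h {..<card D} D"
    using ex_bij_betw_nat_finite[OF assms] by (auto simp: atLeast0LessThan)
  have "segment_sum D = (\<Sum>i<card D. closed_segment (- (1/2) *\<^sub>R h i) ((1/2) *\<^sub>R h i))"
    unfolding segment_sum_eq_sum_segments[OF assms] by (rule sum.reindex_bij_betw[OF h, symmetric])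
  then show ?thesis unfolding zonotope_def
    by (intro exI[of _ "card D"] exI[of _ "\<lambda>i. - (1/2) *\<^sub>R h i"] exI[of _ "\<lambda>i. (1/2) *\<^sub>R h i"])
qed

lemma compact_convex_segment_sum:
  fixes D :: "'a::euclidean_space set"
  assumes "finite D"
  shows "compact (segment_sum D) \<and> convex (segment_sum D)"
  unfolding segment_sum_eq_sum_segments[OF assms] using assms
proof (induction D rule: finite_induct)
  case (insert e D)
  have "A + B = {x + y | x y. x \<in> A \<and> y \<in> B}" for A B :: "'a set"
    by (auto simp: set_plus_def)
  then have "compact (A + B)" if "compact A" "compact B" for A B :: "'a set"
    using compact_sums[OF that] by simp
  then show ?case using insert by (simp add: convex_set_plus)
qed (auto simp: set_zero)

lemma support_segment_sum:
  assumes "finite D"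
  shows "support (segment_sum D) u = (\<Sum>e\<in>D. \<bar>e \<bullet> u\<bar> / 2)"
proof -
  define m where "m = (\<Sum>e\<in>D. (sgn (e \<bullet> u) / 2) *\<^sub>R e)"
  have um: "u \<bullet> m = (\<Sum>e\<in>D. \<bar>e \<bullet> u\<bar> / 2)"
    unfolding m_def inner_sum_right
    by (intro sum.cong) (auto simp: inner_commute sgn_if)
  have "support (segment_sum D) u = u \<bullet> m"
  proof (rule support_eqI)
    show "m \<in> segment_sum D"
      unfolding segment_sum_def m_def by (intro CollectI exI[of _ "\<lambda>e. sgn (e \<bullet> u) / 2"]) (auto simp: sgn_if)
    fix y assume "y \<in> segment_sum D"
    then obtain x where x: "y = (\<Sum>e\<in>D. x e *\<^sub>R e)" "\<And>e. e \<in> D \<Longrightarrow> \<bar>x e\<bar> \<le> 1/2"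
      by (auto simp: segment_sum_def)
    show "u \<bullet> y \<le> u \<bullet> m"
      unfolding um x(1) inner_sum_right
    proof (rule sum_mono)
      fix e assume "e \<in> D"
      have "x e * (e \<bullet> u) \<le> \<bar>x e\<bar> * \<bar>e \<bullet> u\<bar>" by (metis abs_ge_self abs_mult)
      also have "\<dots> \<le> 1/2 * \<bar>e \<bullet> u\<bar>" using x(2)[OF \<open>e \<in> D\<close>] by (intro mult_right_mono) auto
      finally show "u \<bullet> x e *\<^sub>R e \<le> \<bar>e \<bullet> u\<bar> / 2" by (simp add: inner_commute)
    qed
  qed
  then show ?thesis by (simp add: um)
qed

theorem polytope_eq_segment_sum:
  fixes P :: "'a::euclidean_space set"
  assumes P: "polytope P" "polygon_faces_symmetric P" "P \<noteq> {}" and D: "edge_transversal P D"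
    and sym: "\<And>x. x \<in> P \<Longrightarrow> - x \<in> P"
  shows "P = segment_sum D"
proof (rule closed_convex_eq_if_support_eq)
  have fin: "finite D" by (rule edge_transversal_finite[OF P(1) D])
  show "compact (segment_sum D)" "convex (segment_sum D)" using compact_convex_segment_sum[OF fin] by auto
  have "(\<Sum>e\<in>D. 0 *\<^sub>R e) \<in> segment_sum D" unfolding segment_sum_def by (intro CollectI exI[of _ "\<lambda>_. 0"]) auto
  then show "segment_sum D \<noteq> {}" by blast
  show "support P u = support (segment_sum D) u" for u
    using support_eq_sum_edges[OF assms] support_segment_sum[OF fin] by simp
qed (use P in \<open>auto simp: polytope_imp_compact polytope_imp_convex\<close>)

lemma max_face_translation: "max_face ((+) s ` P) u = (+) s ` max_face P u"
  by (auto simp: max_face_def inner_add_right)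

text \<open>Maximising a linear functional over the sum maximises it over each segment separately: segments that
  are not orthogonal to \<open>u\<close> contribute an end point, the others contribute completely.\<close>

lemma max_face_segment_sum:
  fixes D :: "'a::euclidean_space set"
  assumes "finite D"
  shows "max_face (segment_sum D) u =
    (+) (\<Sum>e\<in>{e\<in>D. e \<bullet> u \<noteq> 0}. (sgn (e \<bullet> u) / 2) *\<^sub>R e) ` segment_sum {e\<in>D. e \<bullet> u = 0}"
    (is "_ = (+) ?s ` segment_sum ?Z")
proof -
  let ?N = "{e\<in>D. e \<bullet> u \<noteq> 0}"
  have split: "(\<Sum>e\<in>D. f e) = (\<Sum>e\<in>?N. f e) + (\<Sum>e\<in>?Z. f e)" for f :: "'a \<Rightarrow> 'a"
    using assms by (subst sum.union_disjoint[symmetric]) (auto intro!: sum.cong)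
  have term_le: "x * (e \<bullet> u) \<le> \<bar>e \<bullet> u\<bar> / 2" if "\<bar>x\<bar> \<le> 1/2" for x and e :: 'a
  proof -
    have "x * (e \<bullet> u) \<le> \<bar>x\<bar> * \<bar>e \<bullet> u\<bar>" by (metis abs_ge_self abs_mult)
    also have "\<dots> \<le> 1/2 * \<bar>e \<bullet> u\<bar>" using that by (intro mult_right_mono) auto
    finally show ?thesis by simp
  qed
  have inner_eq: "u \<bullet> (\<Sum>e\<in>D. x e *\<^sub>R e) = (\<Sum>e\<in>D. x e * (e \<bullet> u))" for x
    by (simp add: inner_sum_right inner_commute)
  have max_iff: "(\<Sum>e\<in>D. x e *\<^sub>R e) \<in> max_face (segment_sum D) u \<longleftrightarrow>
      (\<forall>e\<in>D. x e * (e \<bullet> u) = \<bar>e \<bullet> u\<bar> / 2)" if x: "\<forall>e\<in>D. \<bar>x e\<bar> \<le> 1/2" for x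
  proof -
    have in_sum: "(\<Sum>e\<in>D. x e *\<^sub>R e) \<in> segment_sum D" using x by (auto simp: segment_sum_def)
    have co: "compact (segment_sum D)" using compact_convex_segment_sum[OF assms] by blast
    have "(\<Sum>e\<in>D. x e *\<^sub>R e) \<in> max_face (segment_sum D) u \<longleftrightarrow>
        u \<bullet> (\<Sum>e\<in>D. x e *\<^sub>R e) = support (segment_sum D) u"
    proof
      show "(\<Sum>e\<in>D. x e *\<^sub>R e) \<in> max_face (segment_sum D) u \<Longrightarrow>
        u \<bullet> (\<Sum>e\<in>D. x e *\<^sub>R e) = support (segment_sum D) u"
        by (rule support_max_face[symmetric])
      assume "u \<bullet> (\<Sum>e\<in>D. x e *\<^sub>R e) = support (segment_sum D) u"
      then show "(\<Sum>e\<in>D. x e *\<^sub>R e) \<in> max_face (segment_sum D) u"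
        using in_sum support_upper[OF co] by (simp add: max_face_def)
    qed
    also have "\<dots> \<longleftrightarrow> (\<Sum>e\<in>D. \<bar>e \<bullet> u\<bar> / 2 - x e * (e \<bullet> u)) = 0"
      by (auto simp: inner_eq support_segment_sum[OF assms] sum_subtractf)
    also have "\<dots> \<longleftrightarrow> (\<forall>e\<in>D. \<bar>e \<bullet> u\<bar> / 2 - x e * (e \<bullet> u) = 0)"
      using assms x term_le by (intro sum_nonneg_eq_0_iff) auto
    finally show ?thesis by auto
  qed
  show ?thesis
  proof (intro set_eqI iffI)
    fix z assume z: "z \<in> max_face (segment_sum D) u"
    then have "z \<in> segment_sum D" using max_face_subset by blast
    then obtain x where x: "z = (\<Sum>e\<in>D. x e *\<^sub>R e)" "\<forall>e\<in>D. \<bar>x e\<bar> \<le> 1/2"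
      unfolding segment_sum_def by blast
    have eq: "x e * (e \<bullet> u) = \<bar>e \<bullet> u\<bar> / 2" if "e \<in> D" for e
      using max_iff[OF x(2)] z x(1) that by blast
    have "x e = sgn (e \<bullet> u) / 2" if "e \<in> ?N" for e
    proof -
      have "x e * (e \<bullet> u) = (sgn (e \<bullet> u) / 2) * (e \<bullet> u)"
        using eq[of e] that by (simp add: abs_sgn mult.commute)
      then show ?thesis using that by (auto dest: mult_right_cancel[THEN iffD1, rotated])
    qed
    then have "(\<Sum>e\<in>?N. x e *\<^sub>R e) = ?s" by (intro sum.cong) auto
    then have "z = ?s + (\<Sum>e\<in>?Z. x e *\<^sub>R e)"
      unfolding x(1) split by simp
    moreover have "(\<Sum>e\<in>?Z. x e *\<^sub>R e) \<in> segment_sum ?Z"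
      unfolding segment_sum_def using x(2) by (intro CollectI exI[of _ x]) auto
    ultimately show "z \<in> (+) ?s ` segment_sum ?Z" by blast
  next
    fix z assume "z \<in> (+) ?s ` segment_sum ?Z"
    then obtain y where y: "z = ?s + (\<Sum>e\<in>?Z. y e *\<^sub>R e)" "\<forall>e\<in>?Z. \<bar>y e\<bar> \<le> 1/2"
      unfolding segment_sum_def by blast
    define x where "x = (\<lambda>e. if e \<bullet> u = 0 then y e else sgn (e \<bullet> u) / 2)"
    have "z = (\<Sum>e\<in>D. x e *\<^sub>R e)" unfolding y(1) split by (simp add: x_def)
    moreover have "\<forall>e\<in>D. \<bar>x e\<bar> \<le> 1/2" using y(2) by (auto simp: x_def sgn_if)
    moreover have "\<forall>e\<in>D. x e * (e \<bullet> u) = \<bar>e \<bullet> u\<bar> / 2" by (auto simp: x_def sgn_if)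
    ultimately show "z \<in> max_face (segment_sum D) u" using max_iff by blast
  qed
qed

lemma segment_sum_single: "segment_sum {e} = closed_segment (- (1/2) *\<^sub>R e) ((1/2) *\<^sub>R e)"
  by (simp add: segment_sum_eq_sum_segments)

lemma segment_sum_pair:
  assumes "e \<noteq> f"
  shows "segment_sum {e, f} = {x *\<^sub>R e + y *\<^sub>R f | x y. \<bar>x\<bar> \<le> 1/2 \<and> \<bar>y\<bar> \<le> 1/2}"
proof (intro set_eqI iffI)
  fix z assume "z \<in> {x *\<^sub>R e + y *\<^sub>R f | x y. \<bar>x\<bar> \<le> 1/2 \<and> \<bar>y\<bar> \<le> 1/2}"
  then obtain x y where "z = x *\<^sub>R e + y *\<^sub>R f" "\<bar>x\<bar> \<le> 1/2" "\<bar>y\<bar> \<le> 1/2" by blast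
  then show "z \<in> segment_sum {e, f}"
    using assms unfolding segment_sum_def
    by (intro CollectI exI[of _ "\<lambda>g. if g = e then x else y"]) auto
qed (use assms in \<open>auto simp: segment_sum_def\<close>)

section \<open>Ordinary lines and ordinary planes\<close>

text \<open>Positions on a line relative to the foot of a perpendicular: two of any three points lie on
  the same side of the foot, one of them closer to it.\<close>

lemma two_reals_on_one_side:
  fixes x y z :: real
  assumes "x \<noteq> y" "y \<noteq> z" "z \<noteq> x"
  shows "\<exists>a\<in>{x, y, z}. \<exists>b\<in>{x, y, z}. 0 \<le> a * b \<and> \<bar>a\<bar> < \<bar>b\<bar>"
proof -
  have pair: "\<exists>a\<in>{u, v}. \<exists>b\<in>{u, v}. 0 \<le> a * b \<and> \<bar>a\<bar> < \<bar>b\<bar>"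
    if "u \<noteq> v" "0 \<le> u \<and> 0 \<le> v \<or> u \<le> 0 \<and> v \<le> 0" for u v :: real
  proof -
    have "0 \<le> u * v" using that(2) by (auto simp: zero_le_mult_iff)
    moreover have "\<bar>u\<bar> < \<bar>v\<bar> \<or> \<bar>v\<bar> < \<bar>u\<bar>" using that by linarith
    ultimately show ?thesis by (auto simp: mult.commute)
  qed
  consider "0 \<le> x \<and> 0 \<le> y \<or> x \<le> 0 \<and> y \<le> 0" | "0 \<le> y \<and> 0 \<le> z \<or> y \<le> 0 \<and> z \<le> 0"
    | "0 \<le> z \<and> 0 \<le> x \<or> z \<le> 0 \<and> x \<le> 0" by linarith
  then show ?thesis
  proof cases
    case 1 then show ?thesis using pair[OF assms(1)] by blast
  next
    case 2 then show ?thesis using pair[OF assms(2)] by blast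
  next
    case 3 then show ?thesis using pair[OF assms(3)] by blast
  qed
qed

text \<open>The squared distance of \<open>x\<close> from the line through \<open>p\<close> and \<open>q\<close>.\<close>

definition line_dist_sq :: "'a::real_inner \<Rightarrow> 'a \<Rightarrow> 'a \<Rightarrow> real" where
  "line_dist_sq p q x = (x - p) \<bullet> (x - p) - ((x - p) \<bullet> (q - p))\<^sup>2 / ((q - p) \<bullet> (q - p))"

text \<open>Kelly's step. The origin is the foot of the perpendicular from the apex \<open>n\<close> to a line with direction
  \<open>w\<close>. If
  \<open>a *\<^sub>R w\<close> lies between the foot and \<open>b *\<^sub>R w\<close>, it is closer to the line that joins \<open>n\<close> and \<open>b *\<^sub>R w\<close>
  than \<open>n\<close> is to the original line.\<close>

lemma closer_line_through_apex:
  fixes w n :: "'a::real_inner"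
  assumes "n \<noteq> 0" "w \<noteq> 0" "n \<bullet> w = 0" "0 \<le> a * b" "\<bar>a\<bar> < \<bar>b\<bar>"
  shows "line_dist_sq n (b *\<^sub>R w) (a *\<^sub>R w) < n \<bullet> n"
proof -
  define N W where "N = n \<bullet> n" and "W = w \<bullet> w"
  have pos: "N > 0" "W > 0" using assms by (auto simp: N_def W_def)
  define Q where "Q = b\<^sup>2 * W + N"
  have Q: "Q > 0" using pos by (simp add: Q_def add_nonneg_pos)
  have "(a *\<^sub>R w - n) \<bullet> (a *\<^sub>R w - n) = a\<^sup>2 * W + N"
    "(a *\<^sub>R w - n) \<bullet> (b *\<^sub>R w - n) = a * b * W + N"
    "(b *\<^sub>R w - n) \<bullet> (b *\<^sub>R w - n) = Q"
    using assms(3)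
    by (simp_all add: N_def W_def Q_def inner_diff_left inner_diff_right inner_commute power2_eq_square)
  then have "line_dist_sq n (b *\<^sub>R w) (a *\<^sub>R w) = (a\<^sup>2 * W + N) - (a * b * W + N)\<^sup>2 / Q"
    by (simp add: line_dist_sq_def)
  also have "\<dots> = N * (W * (a - b)\<^sup>2) / Q"
    using Q by (simp add: field_simps) (simp add: Q_def power2_eq_square algebra_simps)
  also have "\<dots> < N"
  proof -
    have "(a - b)\<^sup>2 \<le> b\<^sup>2"
    proof -
      have "a * a \<le> a * b"
      proof -
        have "a * a = \<bar>a\<bar> * \<bar>a\<bar>" "a * b = \<bar>a\<bar> * \<bar>b\<bar>"
          using assms(4) by (simp_all flip: abs_mult)
        moreover have "\<bar>a\<bar> * \<bar>a\<bar> \<le> \<bar>a\<bar> * \<bar>b\<bar>"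
          using assms(5) by (intro mult_left_mono) auto
        ultimately show ?thesis by linarith
      qed
      then show ?thesis using assms(4) by (simp add: power2_eq_square algebra_simps)
    qed
    then have "W * (a - b)\<^sup>2 \<le> W * b\<^sup>2"
      using pos by (intro mult_left_mono) auto
    then have "W * (a - b)\<^sup>2 < Q"
      using pos(1) unfolding Q_def mult.commute[of "b\<^sup>2" W] by linarith
    then have "N * (W * (a - b)\<^sup>2) < N * Q" using pos by simp
    then show ?thesis using Q by (simp add: pos_divide_less_eq)
  qed
  finally show ?thesis by (simp add: N_def)
qed

lemma line_dist_sq_translate:
  "line_dist_sq (v + p) (v + q) (v + x) = line_dist_sq p q x"
  by (simp add: line_dist_sq_def)

text \<open>Kelly's proof: choose a line through two points of \<open>X\<close> and a point of \<open>X\<close> off the line at the smallest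
  positive distance from it. A third point of \<open>X\<close> on the line would give, by
  \<open>closer_line_through_apex\<close>, a smaller positive distance.\<close>

theorem sylvester_gallai:
  fixes X :: "'a::euclidean_space set"
  assumes "finite X" and ncol: "\<not> collinear X"
  shows "\<exists>p\<in>X. \<exists>q\<in>X. p \<noteq> q \<and> (\<forall>r\<in>X. collinear {p, q, r} \<longrightarrow> r = p \<or> r = q)"
proof -
  define \<T> where "\<T> = {(p, q, x) \<in> X \<times> X \<times> X. \<not> collinear {p, q, x}}"
  have "finite \<T>"
    by (rule finite_subset[of _ "X \<times> X \<times> X"]) (use \<open>finite X\<close> in \<open>auto simp: \<T>_def\<close>)
  moreover have "\<T> \<noteq> {}"
  proof
    assume "\<T> = {}"
    then have all: "collinear {p, q, x}" if "p \<in> X" "q \<in> X" "x \<in> X" for p q x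
      using that by (auto simp: \<T>_def)
    obtain p q where pq: "p \<in> X" "q \<in> X" "p \<noteq> q"
      using ncol by (metis collinear_sing collinear_subset insertI1 subsetI singletonD insert_iff)
    have "collinear (insert p (insert q X))"
      using all pq by (subst collinear_triples) auto
    then show False using ncol pq by (simp add: insert_absorb)
  qed
  ultimately obtain T where T: "T \<in> \<T>"
    and min: "\<And>T'. T' \<in> \<T> \<Longrightarrow> (case T of (p, q, x) \<Rightarrow> line_dist_sq p q x) \<le> (case T' of (p, q, x) \<Rightarrow> line_dist_sq p q x)"
    using ex_min_if_finite[of "(\<lambda>(p, q, x). line_dist_sq p q x) ` \<T>"]
    by (metis (no_types, lifting) finite_imageI image_iff image_is_empty not_le)
  obtain p q x where T_eq: "T = (p, q, x)" by (cases T)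
  have pqx: "p \<in> X" "q \<in> X" "x \<in> X" "\<not> collinear {p, q, x}" using T by (auto simp: \<T>_def T_eq)
  have "p \<noteq> q" using pqx(4) by (auto simp: collinear_2)
  have "r = p \<or> r = q" if r: "r \<in> X" "collinear {p, q, r}" for r
  proof (rule ccontr)
    assume "\<not> (r = p \<or> r = q)"
    then have "r \<noteq> p" "r \<noteq> q" by auto
    define w where "w = q - p"
    define W where "W = w \<bullet> w"
    have "w \<noteq> 0" "W > 0" using \<open>p \<noteq> q\<close> by (auto simp: w_def W_def)
    define s where "s = ((x - p) \<bullet> w) / W"
    define f where "f = p + s *\<^sub>R w"
    define n where "n = x - f"
    have nw: "n \<bullet> w = 0"
      using \<open>W > 0\<close> by (simp add: n_def f_def s_def inner_diff_left inner_add_left W_def)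
    have on_line: "collinear {p, q, f + k *\<^sub>R w}" for k
    proof -
      have "f + k *\<^sub>R w = p + (s + k) *\<^sub>R (q - p)" by (simp add: f_def w_def algebra_simps)
      then have "collinear {p, f + k *\<^sub>R w, q}"
        unfolding collinear_3_expand
        by (intro disjI2 exI[of _ "1 - (s + k)"]) (simp add: algebra_simps)
      then show ?thesis by (simp add: insert_commute)
    qed
    have "n \<noteq> 0"
    proof
      assume "n = 0"
      then have "collinear {p, q, x}" using on_line[of 0] by (simp add: n_def)
      then show False using pqx(4) by blast
    qed
    have dist: "line_dist_sq p q x = n \<bullet> n"
    proof -
      have xp: "x - p = n + s *\<^sub>R w" by (simp add: n_def f_def)
      have "(x - p) \<bullet> (x - p) = n \<bullet> n + s\<^sup>2 * W" "(x - p) \<bullet> w = s * W"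
        unfolding xp using nw
        by (simp_all add: inner_add_left inner_add_right inner_commute W_def power2_eq_square)
      then show ?thesis
        using \<open>W > 0\<close> by (simp add: line_dist_sq_def w_def[symmetric] W_def[symmetric] power2_eq_square)
    qed
    have "collinear {p, r, q}" using r(2) by (simp add: insert_commute)
    then obtain k where "r = k *\<^sub>R p + (1 - k) *\<^sub>R q"
      using \<open>p \<noteq> q\<close> unfolding collinear_3_expand by blast
    then have r_eq: "r = f + (1 - k - s) *\<^sub>R w"
      by (simp add: f_def w_def algebra_simps)
    have p_eq: "p = f + (0 - s) *\<^sub>R w" and q_eq: "q = f + (1 - s) *\<^sub>R w"
      by (simp_all add: f_def w_def algebra_simps)
    have "k \<noteq> 1" using \<open>r \<noteq> p\<close> r_eq p_eq by auto
    moreover have "k \<noteq> 0" using \<open>r \<noteq> q\<close> r_eq q_eq by auto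
    ultimately have distinct: "0 - s \<noteq> 1 - s" "1 - s \<noteq> 1 - k - s" "1 - k - s \<noteq> 0 - s" by auto
    obtain a b where ab: "a \<in> {0 - s, 1 - s, 1 - k - s}" "b \<in> {0 - s, 1 - s, 1 - k - s}"
        "0 \<le> a * b" "\<bar>a\<bar> < \<bar>b\<bar>"
      using two_reals_on_one_side[OF distinct] by (elim bexE conjE) (rule that)
    have inX: "f + c *\<^sub>R w \<in> X" if "c \<in> {0 - s, 1 - s, 1 - k - s}" for c
      using that pqx(1,2) r(1) p_eq q_eq r_eq by auto
    have "\<not> collinear {x, f + b *\<^sub>R w, f + a *\<^sub>R w}"
    proof
      assume "collinear {x, f + b *\<^sub>R w, f + a *\<^sub>R w}"
      then have "collinear {f + b *\<^sub>R w, x, f + a *\<^sub>R w}" by (simp add: insert_commute)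
      moreover have "f + b *\<^sub>R w \<noteq> f + a *\<^sub>R w" using ab(4) \<open>w \<noteq> 0\<close> by auto
      ultimately obtain u where "x = u *\<^sub>R (f + b *\<^sub>R w) + (1 - u) *\<^sub>R (f + a *\<^sub>R w)"
        unfolding collinear_3_expand by blast
      then have "x = f + (u * b + (1 - u) * a) *\<^sub>R w" by (simp add: algebra_simps)
      then show False using on_line pqx(4) by metis
    qed
    then have "(x, f + b *\<^sub>R w, f + a *\<^sub>R w) \<in> \<T>"
      using inX ab(1,2) pqx(3) by (simp add: \<T>_def)
    then have "line_dist_sq p q x \<le> line_dist_sq x (f + b *\<^sub>R w) (f + a *\<^sub>R w)"
      using min by (fastforce simp: T_eq)
    also have "\<dots> = line_dist_sq n (b *\<^sub>R w) (a *\<^sub>R w)"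
      using line_dist_sq_translate[of f n] by (simp add: n_def)
    also have "\<dots> < n \<bullet> n"
      by (rule closer_line_through_apex[OF \<open>n \<noteq> 0\<close> \<open>w \<noteq> 0\<close> nw ab(3,4)])
    finally show False using dist by simp
  qed
  then show ?thesis using pqx(1,2) \<open>p \<noteq> q\<close> by blast
qed

lemma dim_nonparallel_pair:
  fixes e f :: "'a::euclidean_space"
  assumes "f \<noteq> 0" "\<And>k. e \<noteq> k *\<^sub>R f"
  shows "dim {e, f} = 2"
  using assms by (auto simp: dim_insert span_singleton)

lemma span_pairE:
  assumes "z \<in> span {e, f}"
  obtains a b where "z = a *\<^sub>R e + b *\<^sub>R f"
proof -
  obtain a where "z - a *\<^sub>R e \<in> span {f}" using assms span_breakdown_eq by blast
  then obtain b where "z - a *\<^sub>R e = b *\<^sub>R f" by (auto simp: span_singleton)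
  then show ?thesis using that[of a b] by (simp add: algebra_simps)
qed

text \<open>Scaling the vectors into the affine plane \<open>c \<bullet> x = 1\<close> turns them into points, distinct for distinct
  vectors and not collinear as the vectors span the space. A line through exactly two of the points
  spans with the origin a plane that contains exactly two of the vectors.\<close>

lemma ordinary_plane:
  fixes D :: "'a::euclidean_space set"
  assumes dim: "DIM('a) = 3" and fin: "finite D"
    and c: "\<And>e. e \<in> D \<Longrightarrow> 0 < c \<bullet> e"
    and np: "\<And>e k. e \<in> D \<Longrightarrow> k *\<^sub>R e \<in> D \<Longrightarrow> k = 1"
    and spans: "\<And>u. u \<noteq> 0 \<Longrightarrow> \<exists>e\<in>D. e \<bullet> u \<noteq> 0"
  obtains e f n where "e \<in> D" "f \<in> D" "\<And>k. e \<noteq> k *\<^sub>R f" "{g\<in>D. g \<bullet> n = 0} = {e, f}"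
proof -
  define pt where "pt e = (1 / (c \<bullet> e)) *\<^sub>R e" for e
  have pt: "e = (c \<bullet> e) *\<^sub>R pt e" "c \<bullet> pt e = 1" if "e \<in> D" for e
    using c[OF that] by (simp_all add: pt_def)
  have small: "dim {a, b} < DIM('a)" for a b :: 'a
    using dim dim_le_card'[of "{a, b}"] card_insert_le_m1[of 2 "{b}" a] by simp
  have inj: "e = f" if "e \<in> D" "f \<in> D" "pt e = pt f" for e f
  proof -
    have "e = (c \<bullet> e) *\<^sub>R pt f" using pt(1)[OF that(1)] that(3) by simp
    then have "e = ((c \<bullet> e) / (c \<bullet> f)) *\<^sub>R f" by (simp add: pt_def)
    moreover from this have "(c \<bullet> e) / (c \<bullet> f) = 1" using np[OF that(2)] that(1) by metis
    ultimately show ?thesis by simp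
  qed
  have "\<not> collinear (pt ` D)"
  proof
    assume "collinear (pt ` D)"
    then obtain w where w: "\<And>x y. x \<in> pt ` D \<Longrightarrow> y \<in> pt ` D \<Longrightarrow> \<exists>k. x - y = k *\<^sub>R w"
      unfolding collinear_def by blast
    have "D \<noteq> {}"
    proof -
      obtain b :: 'a where "b \<in> Basis" using nonempty_Basis by blast
      then have "b \<noteq> 0" by (rule nonzero_Basis)
      then show ?thesis using spans by blast
    qed
    then obtain e0 where e0: "e0 \<in> D" by blast
    obtain n where n: "n \<noteq> 0" "\<And>y. y \<in> span {pt e0, w} \<Longrightarrow> orthogonal n y"
      using orthogonal_to_subspace_exists[OF small] by blast
    have n2: "n \<bullet> pt e0 = 0" "n \<bullet> w = 0"
      using n(2) by (auto simp: orthogonal_def intro: span_base)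
    have "e \<bullet> n = 0" if e: "e \<in> D" for e
    proof -
      obtain k where "pt e - pt e0 = k *\<^sub>R w" using w e e0 by blast
      then have "pt e = pt e0 + k *\<^sub>R w" by (simp add: algebra_simps)
      then have "n \<bullet> pt e = 0" using n2 by (simp add: inner_add_right)
      then have "n \<bullet> ((c \<bullet> e) *\<^sub>R pt e) = 0" by simp
      then show ?thesis using pt(1)[OF e] by (simp add: inner_commute)
    qed
    then show False using spans[OF n(1)] by blast
  qed
  then obtain e f where ef: "e \<in> D" "f \<in> D" "pt e \<noteq> pt f"
    and ord: "\<And>r. r \<in> pt ` D \<Longrightarrow> collinear {pt e, pt f, r} \<Longrightarrow> r = pt e \<or> r = pt f"
    using sylvester_gallai[of "pt ` D"] fin by blast
  have nonpar: "e \<noteq> k *\<^sub>R f" for k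
  proof
    assume "e = k *\<^sub>R f"
    then have "k = 1" using np[OF ef(2)] ef(1) by blast
    then show False using \<open>e = k *\<^sub>R f\<close> ef(3) by simp
  qed
  have "f \<noteq> 0" using c[OF ef(2)] by auto
  obtain n where n: "n \<noteq> 0" "\<And>y. y \<in> span {e, f} \<Longrightarrow> orthogonal n y"
    using orthogonal_to_subspace_exists[OF small] by blast
  have nef: "n \<bullet> e = 0" "n \<bullet> f = 0"
    using n(2) by (auto simp: orthogonal_def intro: span_base)
  have plane: "span {e, f} = span {x. n \<bullet> x = 0}"
  proof (rule dim_eq_span)
    show "dim {x. n \<bullet> x = 0} \<le> dim {e, f}"
      using dim_nonparallel_pair[OF \<open>f \<noteq> 0\<close> nonpar] dim_hyperplane[OF n(1)] dim by simp
  qed (use nef in auto)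
  have "g = e \<or> g = f" if g: "g \<in> D" "g \<bullet> n = 0" for g
  proof -
    have "g \<in> span {e, f}" unfolding plane using g(2) by (intro span_base) (simp add: inner_commute)
    then obtain a b where ab: "g = a *\<^sub>R e + b *\<^sub>R f" by (rule span_pairE)
    define a' b' where "a' = a * (c \<bullet> e) / (c \<bullet> g)" and "b' = b * (c \<bullet> f) / (c \<bullet> g)"
    have "pt g = (1 / (c \<bullet> g)) *\<^sub>R (a *\<^sub>R ((c \<bullet> e) *\<^sub>R pt e) + b *\<^sub>R ((c \<bullet> f) *\<^sub>R pt f))"
      using ab pt(1)[OF ef(1)] pt(1)[OF ef(2)] by (simp add: pt_def)
    then have comb: "pt g = a' *\<^sub>R pt e + b' *\<^sub>R pt f"
      by (simp add: a'_def b'_def scaleR_add_right)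
    then have "c \<bullet> pt g = a' * (c \<bullet> pt e) + b' * (c \<bullet> pt f)" by (simp add: inner_add_right)
    then have "b' = 1 - a'" using pt(2) g(1) ef by simp
    then have "collinear {pt e, pt g, pt f}"
      unfolding collinear_3_expand using comb by blast
    then have "collinear {pt e, pt f, pt g}" by (simp add: insert_commute)
    then show ?thesis using ord g(1) inj ef by blast
  qed
  then have "{g\<in>D. g \<bullet> n = 0} = {e, f}"
    using nef ef by (auto simp: inner_commute)
  then show ?thesis using that ef nonpar by blast
qed

section \<open>Zonotopes and rectangular faces\<close>

lemma parallelogram_hull:
  fixes a u v :: "'a::real_vector"
  shows "convex hull {a, a + u, a + u + v, a + v} =
    {a + x *\<^sub>R u + y *\<^sub>R v | x y. 0 \<le> x \<and> x \<le> 1 \<and> 0 \<le> y \<and> y \<le> 1}" (is "_ = ?Q")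
proof
  have "convex ?Q"
  proof (rule convexI)
    fix p q s t assume pq: "p \<in> ?Q" "q \<in> ?Q" and st: "0 \<le> s" "0 \<le> t" "s + t = (1::real)"
    obtain x y where p: "p = a + x *\<^sub>R u + y *\<^sub>R v" "0 \<le> x" "x \<le> 1" "0 \<le> y" "y \<le> 1" using pq(1) by blast
    obtain x' y' where q: "q = a + x' *\<^sub>R u + y' *\<^sub>R v" "0 \<le> x'" "x' \<le> 1" "0 \<le> y'" "y' \<le> 1" using pq(2) by blast
    have "s *\<^sub>R p + t *\<^sub>R q = (s + t) *\<^sub>R a + (s * x + t * x') *\<^sub>R u + (s * y + t * y') *\<^sub>R v"
      by (simp add: p(1) q(1) algebra_simps)
    moreover have "0 \<le> s * x + t * x'" "0 \<le> s * y + t * y'" using st p q by auto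
    moreover have "s * x + t * x' \<le> 1" "s * y + t * y' \<le> 1"
      using st p q by (auto intro: convex_bound_le)
    ultimately show "s *\<^sub>R p + t *\<^sub>R q \<in> ?Q" using st(3) by auto
  qed
  moreover have "{a, a + u, a + u + v, a + v} \<subseteq> ?Q"
  proof -
    have "a + x *\<^sub>R u + y *\<^sub>R v \<in> ?Q" if "x \<in> {0, 1}" "y \<in> {0, 1}" for x y
      using that by (intro CollectI exI[of _ x] exI[of _ y]) auto
    from this[of 0 0] this[of 1 0] this[of 1 1] this[of 0 1] show ?thesis by simp
  qed
  ultimately show "convex hull {a, a + u, a + u + v, a + v} \<subseteq> ?Q" by (rule hull_minimal[rotated])
  show "?Q \<subseteq> convex hull {a, a + u, a + u + v, a + v}" (is "_ \<subseteq> ?H")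
  proof clarify
    fix x y :: real assume xy: "0 \<le> x" "x \<le> 1" "0 \<le> y" "y \<le> 1"
    have cv: "convex ?H" by (rule convex_convex_hull)
    have in_H: "a \<in> ?H" "a + u \<in> ?H" "a + u + v \<in> ?H" "a + v \<in> ?H" by (auto intro: hull_inc)
    have "(1 - x) *\<^sub>R a + x *\<^sub>R (a + u) \<in> ?H" "(1 - x) *\<^sub>R (a + v) + x *\<^sub>R (a + u + v) \<in> ?H"
      using in_H xy by (auto intro!: convexD[OF cv])
    then have "(1 - y) *\<^sub>R ((1 - x) *\<^sub>R a + x *\<^sub>R (a + u))
        + y *\<^sub>R ((1 - x) *\<^sub>R (a + v) + x *\<^sub>R (a + u + v)) \<in> ?H"
      using xy by (auto intro!: convexD[OF cv])
    also have "(1 - y) *\<^sub>R ((1 - x) *\<^sub>R a + x *\<^sub>R (a + u))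
        + y *\<^sub>R ((1 - x) *\<^sub>R (a + v) + x *\<^sub>R (a + u + v)) = a + x *\<^sub>R u + y *\<^sub>R v"
      by (simp add: algebra_simps)
    finally show "a + x *\<^sub>R u + y *\<^sub>R v \<in> ?H" .
  qed
qed

context reflecting_polytope
begin

lemma polygon_faces_symmetric: "polygon_faces_symmetric P"
  unfolding polygon_faces_symmetric_def
proof (intro allI impI)
  fix G assume G: "G face_of P \<and> aff_dim G = 2"
  then have "G \<noteq> {}" by auto
  then obtain f where "foot_of f G" using face_has_foot G by blast
  then show "\<exists>s. \<forall>x\<in>G. s - x \<in> G" using face_symmetric_about_foot G by blast
qed

lemma zonotope:
  assumes "P \<noteq> {}"
  shows "zonotope P"
proof -
  obtain D where D: "edge_transversal P D" using edge_transversal_exists[OF polytope] .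
  have "P = segment_sum D"
    by (rule polytope_eq_segment_sum[OF polytope polygon_faces_symmetric assms D sym])
  then show ?thesis using zonotope_segment_sum[OF edge_transversal_finite[OF polytope D]] by simp
qed

text \<open>The normal \<open>n\<close> of a plane containing exactly two edge vectors \<open>e\<close>, \<open>f\<close> exposes a parallelogram with
  centre \<open>s\<close> and sides \<open>e\<close>, \<open>f\<close>. The ends of its two sides parallel to \<open>e\<close> are equally far from the
  origin, so the midpoints \<open>s + f/2\<close> and \<open>s - f/2\<close> of these sides are orthogonal to \<open>e\<close>; hence so is their
  difference \<open>f\<close>.\<close>

lemma rectangular_face:
  assumes dim: "DIM('a) = 3" and int: "interior P \<noteq> {}"
  shows "\<exists>F. F face_of P \<and> aff_dim F = 2 \<and> rectangle F"
proof -
  have "P \<noteq> {}" using int by auto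
  obtain D where D: "edge_transversal P D" using edge_transversal_exists[OF polytope] .
  have fin: "finite D" by (rule edge_transversal_finite[OF polytope D])
  have PD: "P = segment_sum D"
    by (rule polytope_eq_segment_sum[OF polytope polygon_faces_symmetric \<open>P \<noteq> {}\<close> D sym])
  obtain c where c: "\<And>e. e \<in> D \<Longrightarrow> 0 < c \<bullet> e" using D by (auto simp: edge_transversal_def)
  have np: "k = 1" if "e \<in> D" "k *\<^sub>R e \<in> D" for e k
    by (rule edge_transversal_nonparallel[OF polytope polygon_faces_symmetric D that])
  have spans: "\<exists>e\<in>D. e \<bullet> u \<noteq> 0" if "u \<noteq> 0" for u
  proof (rule ccontr)
    assume "\<not> (\<exists>e\<in>D. e \<bullet> u \<noteq> 0)"
    then have "u \<bullet> e = 0" if "e \<in> D" for e using that by (simp add: inner_commute)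
    then have "P \<subseteq> {x. u \<bullet> x = 0}"
      unfolding PD segment_sum_def by (auto simp: inner_sum_right)
    then have "interior P \<subseteq> interior {x. u \<bullet> x = 0}" by (rule interior_mono)
    then show False using int interior_hyperplane[OF that] by auto
  qed
  obtain e f n where ef: "e \<in> D" "f \<in> D" "\<And>k. e \<noteq> k *\<^sub>R f" "{g\<in>D. g \<bullet> n = 0} = {e, f}"
  proof (rule ordinary_plane[where c = c, OF dim fin])
    show "0 < c \<bullet> e" if "e \<in> D" for e using that by (rule c)
    show "k = 1" if "e \<in> D" "k *\<^sub>R e \<in> D" for e k using that by (rule np)
    show "\<exists>e\<in>D. e \<bullet> u \<noteq> 0" if "u \<noteq> 0" for u using that by (rule spans)
  qed (rule that)
  have "e \<noteq> f" using ef(3)[of 1] by simp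
  have nz: "e \<noteq> 0" "f \<noteq> 0" using c[OF ef(1)] c[OF ef(2)] by auto
  have fe: "f \<noteq> k *\<^sub>R e" for k
  proof
    assume "f = k *\<^sub>R e"
    then have "k = 1" using np[OF ef(1)] ef(2) by blast
    then show False using \<open>f = k *\<^sub>R e\<close> \<open>e \<noteq> f\<close> by simp
  qed
  define s where "s = (\<Sum>g\<in>{g\<in>D. g \<bullet> n \<noteq> 0}. (sgn (g \<bullet> n) / 2) *\<^sub>R g)"
  define G where "G = (+) s ` segment_sum {e, f}"
  have G_max: "G = max_face P n"
    unfolding G_def s_def PD max_face_segment_sum[OF fin] ef(4) ..
  then have GP: "G face_of P" using max_face_face_of[OF convex] by simp
  then have cvG: "convex G" by (rule face_of_imp_convex)
  have side: "(s + (t / 2) *\<^sub>R f) \<bullet> e = 0" if t: "t = 1 \<or> t = - 1" for t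
  proof -
    \<comment> \<open>within the parallelogram, d is an outer normal of one of the two sides parallel to e\<close>
    define d where "d = t *\<^sub>R (f - ((f \<bullet> e) / (e \<bullet> e)) *\<^sub>R e)"
    have de: "e \<bullet> d = 0"
      using nz(1) by (simp add: d_def inner_diff_right inner_commute)
    have "d \<noteq> 0" using t fe by (auto simp: d_def)
    have "t * (f \<bullet> d) = d \<bullet> d"
    proof -
      have "t *\<^sub>R f = d + (t * ((f \<bullet> e) / (e \<bullet> e))) *\<^sub>R e" by (simp add: d_def scaleR_diff_right)
      then have "(t *\<^sub>R f) \<bullet> d = d \<bullet> d" using de by (simp add: inner_add_left)
      then show ?thesis by simp
    qed
    then have "0 < t * (f \<bullet> d)" using \<open>d \<noteq> 0\<close> by simp
    then have fd: "f \<bullet> d \<noteq> 0" "sgn (f \<bullet> d) = t"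
      using t by (auto simp: sgn_if)
    have sets: "{g\<in>{e, f}. g \<bullet> d \<noteq> 0} = {f}" "{g\<in>{e, f}. g \<bullet> d = 0} = {e}"
      using de fd(1) by auto
    have "max_face (segment_sum {e, f}) d = (+) ((t / 2) *\<^sub>R f) ` segment_sum {e}"
      using max_face_segment_sum[of "{e, f}" d] unfolding sets by (simp add: fd(2))
    then have "max_face G d = (+) s ` (+) ((t / 2) *\<^sub>R f) ` segment_sum {e}"
      by (simp only: G_def max_face_translation)
    also have "\<dots> = closed_segment (s + (t / 2) *\<^sub>R f - (1/2) *\<^sub>R e) (s + (t / 2) *\<^sub>R f + (1/2) *\<^sub>R e)"
      unfolding segment_sum_single closed_segment_translation[symmetric]
      by (simp add: add.assoc algebra_simps)
    finally have "closed_segment (s + (t / 2) *\<^sub>R f - (1/2) *\<^sub>R e) (s + (t / 2) *\<^sub>R f + (1/2) *\<^sub>R e) face_of P"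
      using max_face_face_of[OF cvG, of d] GP face_of_trans by metis
    then have "norm (s + (t / 2) *\<^sub>R f - (1/2) *\<^sub>R e) = norm (s + (t / 2) *\<^sub>R f + (1/2) *\<^sub>R e)"
      by (rule edge_ends_equidistant)
    then have "(s + (t / 2) *\<^sub>R f - (1/2) *\<^sub>R e) \<bullet> (s + (t / 2) *\<^sub>R f - (1/2) *\<^sub>R e)
        = (s + (t / 2) *\<^sub>R f + (1/2) *\<^sub>R e) \<bullet> (s + (t / 2) *\<^sub>R f + (1/2) *\<^sub>R e)"
      by (simp add: norm_eq)
    moreover have "(p - (1/2) *\<^sub>R e) \<bullet> (p - (1/2) *\<^sub>R e) = p \<bullet> p - p \<bullet> e + (e \<bullet> e) / 4"
      "(p + (1/2) *\<^sub>R e) \<bullet> (p + (1/2) *\<^sub>R e) = p \<bullet> p + p \<bullet> e + (e \<bullet> e) / 4" for p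
      by (simp_all add: inner_diff_left inner_diff_right inner_add_left inner_add_right inner_commute)
    ultimately show ?thesis by simp
  qed
  have "e \<bullet> f = 0"
    using side[of 1] side[of "- 1"] 
    by (simp add: inner_add_right inner_diff_right inner_commute[of _ e])
  have zp: "segment_sum {e, f} = {x *\<^sub>R e + y *\<^sub>R f | x y. \<bar>x\<bar> \<le> 1/2 \<and> \<bar>y\<bar> \<le> 1/2}"
    by (rule segment_sum_pair[OF \<open>e \<noteq> f\<close>])
  define a where "a = s - (1/2) *\<^sub>R e - (1/2) *\<^sub>R f"
  have "G = {a + x *\<^sub>R e + y *\<^sub>R f | x y. 0 \<le> x \<and> x \<le> 1 \<and> 0 \<le> y \<and> y \<le> 1}" (is "_ = ?Q")
  proof (intro set_eqI iffI)
    fix z assume "z \<in> G"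
    then obtain x y where xy: "z = s + (x *\<^sub>R e + y *\<^sub>R f)" "\<bar>x\<bar> \<le> 1/2" "\<bar>y\<bar> \<le> 1/2"
      unfolding G_def zp by blast
    have "z = a + (x + 1/2) *\<^sub>R e + (y + 1/2) *\<^sub>R f"
      by (simp add: xy(1) a_def scaleR_add_left)
    moreover have "0 \<le> x + 1/2" "x + 1/2 \<le> 1" "0 \<le> y + 1/2" "y + 1/2 \<le> 1"
      using xy(2,3) by linarith+
    ultimately show "z \<in> ?Q" by blast
  next
    fix z assume "z \<in> ?Q"
    then obtain x y where xy: "z = a + x *\<^sub>R e + y *\<^sub>R f" "0 \<le> x" "x \<le> 1" "0 \<le> y" "y \<le> 1" by blast
    have "z = s + ((x - 1/2) *\<^sub>R e + (y - 1/2) *\<^sub>R f)"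
      by (simp add: xy(1) a_def scaleR_diff_left)
    moreover have "\<bar>x - 1/2\<bar> \<le> 1/2" "\<bar>y - 1/2\<bar> \<le> 1/2" using xy(2-5) by linarith+
    ultimately show "z \<in> G" unfolding G_def zp by blast
  qed
  then have "rectangle G"
    unfolding rectangle_def using \<open>e \<bullet> f = 0\<close> nz parallelogram_hull[of a e f] by metis
  moreover have "aff_dim G = 2"
  proof -
    have "0 \<in> segment_sum {e, f}" "e \<in> span (segment_sum {e, f})" "f \<in> span (segment_sum {e, f})"
    proof -
      have in_z: "x *\<^sub>R e + y *\<^sub>R f \<in> segment_sum {e, f}" if "\<bar>x\<bar> \<le> 1/2" "\<bar>y\<bar> \<le> 1/2" for x y
        unfolding zp using that by blast
      show "0 \<in> segment_sum {e, f}" using in_z[of 0 0] by simp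
      have "2 *\<^sub>R ((1/2) *\<^sub>R e + 0 *\<^sub>R f) \<in> span (segment_sum {e, f})"
        by (intro span_scale span_base in_z) auto
      then show "e \<in> span (segment_sum {e, f})" by simp
      have "2 *\<^sub>R (0 *\<^sub>R e + (1/2) *\<^sub>R f) \<in> span (segment_sum {e, f})"
        by (intro span_scale span_base in_z) auto
      then show "f \<in> span (segment_sum {e, f})" by simp
    qed
    moreover have "segment_sum {e, f} \<subseteq> span {e, f}"
      unfolding zp by (auto intro!: span_add span_scale intro: span_base)
    ultimately have "dim (segment_sum {e, f}) = dim {e, f}"
      by (intro order_antisym dim_mono) auto
    then have "dim (segment_sum {e, f}) = 2" using dim_nonparallel_pair[OF nz(2) ef(3)] by simp
    then have "aff_dim (segment_sum {e, f}) = 2"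
      using aff_dim_zero[of "segment_sum {e, f}"] \<open>0 \<in> segment_sum {e, f}\<close> hull_inc by fastforce
    then show ?thesis unfolding G_def by (simp add: aff_dim_translation_eq)
  qed
  ultimately show ?thesis using GP by blast
qed

end

theorem theorem2:
  fixes P :: "(real ^ 'n) set"
  assumes "CARD('n) \<ge> 2"
    and "polytope P"
    and "interior P \<noteq> {}"
    and "P = uminus ` P"
    and "avg_normals P = 3 ^ CARD('n) - 1"
  shows "zonotope P \<and>
    (CARD('n) = 3 \<longrightarrow>
      (\<forall>F. F face_of P \<and> aff_dim F = 2 \<longrightarrow> (\<forall>\<theta>\<in>polygon_angles F. \<not> \<theta> < pi / 2)) \<and>
      (\<exists>F. F face_of P \<and> aff_dim F = 2 \<and> rectangle F))"
proof -
  interpret reflecting_polytope P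
  proof
    show "polytope P" by fact
    show "- x \<in> P" if "x \<in> P" for x using that assms(4) by (metis imageI)
    show "reflect_nearest P (3 *\<^sub>R x) \<in> P" if "x \<in> P" for x
      using assms(2-5) that by (intro reflect_nearest_dilate_subset) auto
  qed
  have "P \<noteq> {}" using assms(3) by auto
  then show ?thesis
    using zonotope polygon_angle_not_acute rectangular_face assms(3) by auto
qed

end
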